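(* For the free-infinitely divisible Voiculescu transform $$V_{\tilde S}(iw)=-F_{\tilde S}(iw)=i\Big[w\,\psi\Big(\frac{w}{2}\Big)-w\log\Big(\frac{w}{2}\Big)+1\Big],\qquad w>0,$$ the characteristics are given by $a_{\tilde S}=b_{\tilde S}=0$, and the measure $\rho_{\tilde S}$ is such that $\rho_{\tilde S}(\mathbb{R})=\gamma+\log2-1$ and, for all $s\in\mathbb{R}$, $$\mathfrak{F}[\rho_{\tilde S}\,;\,s]=\frac{e^{-s}\,\mathrm{Ei}(s)+e^{s}\,\mathrm{Ei}(-s)}{2}+\cosh(s)\,\log\Big(\frac{1+e^{-|s|}}{1-e^{-|s|}}\Big)-1=2\int_0^\infty\cos(sx)\,\frac{x}{(1+x^2)\left(e^{\pi x}-1\right)}\,dx,$$ where the middle expression is understood by continuity at $s=0$.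
   Context: $\psi=\Gamma'/\Gamma$ is the digamma function, and $\gamma=-\psi(1)$ is the Euler-Mascheroni constant. $\mathrm{Ei}$ is the exponential integral function: $\mathrm{Ei}(x)=-\int_{-x}^\infty\frac{e^{-t}}{t}\,dt$ for $x<0$, and for $x>0$ it is defined by the Cauchy principal value $\mathrm{Ei}(x)=-\lim_{\epsilon\to0^+}\big[\int_{-x}^{-\epsilon}\frac{e^{-t}}{t}dt+\int_\epsilon^\infty\frac{e^{-t}}{t}dt\big]$. Equivalently, $\mathrm{Ei}(x)=\gamma+\log|x|+\sum_{k\ge1}\frac{x^k}{k\cdot k!}$ for $x\ne0$. The characteristics $(a_X,b_X,\rho_X)$ of $F_X$ are the unique $a_X\in\mathbb{R}$, $b_X\ge0$ and finite non-negative Borel measure $\rho_X$ on $\mathbb{R}$ such that $$F_X(iw)=a_X+i\,b_X\,w+\int_{\mathbb{R}}\frac{iwx-1}{iw+x}\,\rho_X(dx),\qquad w>0.$$ Here $V_X=-F_X$, and $\mathfrak{F}[\rho\,;\,s]=\int_{\mathbb{R}}e^{isx}\rho(dx)$. The label $\tilde S$ refers to the free-probability analog of the random variable $S$ with characteristic function $s/\sinh(s)$; the function $F_{\tilde S}$ is the one explicitly given in the claim. *)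

theory Defs
  imports "HOL-Probability.Probability"
begin

definition Ei :: "real \<Rightarrow> real" where
  "Ei x =
     (if x < 0 then - (LBINT t:{-x..}. exp (- t) / t)
      else - Lim (at_right 0) (\<lambda>\<epsilon>. (LBINT t:{-x..-\<epsilon>}. exp (- t) / t)
                                 + (LBINT t:{\<epsilon>..}. exp (- t) / t)))"
  \<comment> \<open>For \<open>x > 0\<close> this is the principal value; at \<open>x = 0\<close>, where the exponential integral is
    undefined, the value is unspecified.\<close>

definition has_characteristics ::
    "(complex \<Rightarrow> complex) \<Rightarrow> real \<Rightarrow> real \<Rightarrow> real measure \<Rightarrow> bool" where
  "has_characteristics F a b \<rho> \<longleftrightarrow>
     b \<ge> 0 \<and> finite_borel_measure \<rho> \<and>
     (\<forall>w::real. w > 0 \<longrightarrow>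
        F (\<i> * of_real w) = of_real a + \<i> * of_real b * of_real w
          + (\<integral>x. (\<i> * of_real w * of_real x - 1) / (\<i> * of_real w + of_real x) \<partial>\<rho>))"
  \<comment> \<open>For \<open>w > 0\<close> the integrand is continuous and bounded in \<open>x\<close>, hence integrable.\<close>

definition fourier_S :: "real \<Rightarrow> real" where
  "fourier_S s = (exp (- s) * Ei s + exp s * Ei (- s)) / 2
     + cosh s * ln ((1 + exp (- \<bar>s\<bar>)) / (1 - exp (- \<bar>s\<bar>))) - 1"
  \<comment> \<open>Meaningful for \<open>s \<noteq> 0\<close> only; at \<open>s = 0\<close> the singularity is removable.\<close>

end

theory Submission
  imports Defs "HOL-Real_Asymp.Real_Asymp"
begin

text \<open>
  Let \<open>\<rho>\<close> have the even density \<open>\<bar>x\<bar> / ((1 + x\<^sup>2) (exp (\<pi>\<bar>x\<bar>) - 1))\<close>. Two transforms of \<open>\<rho>\<close> have to be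
  computed, the Nevanlinna integral on the imaginary axis and the Fourier transform, and it has to be
  shown that the former determines the characteristics.

  Both computations rest on the sine transform of the Bose weight \<open>1 / (exp (\<pi>x) - 1)\<close>, which is
  \<open>L u / 2\<close> for the Langevin function \<open>L u = coth u - 1/u\<close> (\<open>sine_transform_bose\<close>). This is the partial
  fraction expansion of \<open>coth\<close>, a consequence of Euler's reflection formula. By Fubini,
  \<open>\<integral> exp (-w t) L (t + s) dt\<close> over \<open>t > 0\<close> equals
  \<open>2 \<integral> bose x (w sin (s x) + x cos (s x)) / (w\<^sup>2 + x\<^sup>2) dx\<close> over \<open>x > 0\<close> (\<open>Laplace_langevin_shift\<close>).

  For \<open>s = 0\<close> the right-hand side is, up to the factor \<open>\<i> w\<close>, the Nevanlinna integral of \<open>\<rho>\<close>; the left-hand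
  side is the Laplace transform of \<open>L\<close>, which Binet's formula expresses by the digamma function
  (\<open>Laplace_langevin\<close>). This shows that \<open>(0, 0, \<rho>)\<close> are characteristics of \<open>F\<close>, and \<open>w = 1\<close> gives the mass.

  For \<open>w = 1\<close>, summing over \<open>s\<close> and \<open>-s\<close> turns the right-hand side into twice the Fourier transform of \<open>\<rho>\<close>. On
  the left-hand side, \<open>exp (-u) L u\<close> is integrated over half-lines: its antiderivatives are elementary
  except for \<open>exp (-u) / u\<close> and \<open>sinh u / u\<close>, which give the exponential integral on the negative axis
  and its principal-value continuation to the positive axis (\<open>cosine_transform_eq_fourier_S\<close>). The behaviour of the closed
  form at \<open>s = 0\<close> follows from the continuity of the characteristic function.

  For uniqueness, the Nevanlinna integral of any finite measure is
  \<open>\<i> w m + \<i> (1 - w\<^sup>2) \<Lambda> w\<close>, where \<open>m\<close> is the mass and \<open>\<Lambda>\<close> the Laplace transform of the characteristic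
  function. Hence \<open>F\<close> determines \<open>\<Lambda>\<close>, by Lerch's theorem the characteristic function, and by
  Levy's theorem the measure (\<open>has_characteristics_unique\<close>).
\<close>

section \<open>Integration over half-lines\<close>

lemma halfline_FTC:
  fixes f F :: "real \<Rightarrow> 'a::euclidean_space"
  assumes deriv: "\<And>x. x > a \<Longrightarrow> (F has_vector_derivative f x) (at x)"
    and cont: "\<And>x. x > a \<Longrightarrow> isCont f x"
    and int: "set_integrable lborel {a<..} f"
    and A: "(F \<longlongrightarrow> A) (at_right a)" and B: "(F \<longlongrightarrow> B) at_top"
  shows "(LBINT x:{a<..}. f x) = B - A"
proof -
  have "(LBINT x=ereal a..\<infinity>. f x) = B - A"
    by (rule interval_integral_FTC_integrable[where F = F])
       (use assms in \<open>auto simp: ereal_tendsto_simps\<close>)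
  thus ?thesis by (simp add: interval_lebesgue_integral_def)
qed

lemma
  fixes z :: complex
  assumes "Re z > 0"
  shows set_integrable_exp_halfline: "set_integrable lborel {0<..} (\<lambda>x. exp (- (z * of_real x)))"
    and LBINT_exp_halfline: "(LBINT x:{0<..}. exp (- (z * of_real x))) = 1 / z"
proof -
  have "set_integrable lborel {0<..} (\<lambda>x. exp (- (x * Re z)))"
    by (rule integrable_I0i_exp_mscale) fact
  thus *: "set_integrable lborel {0<..} (\<lambda>x. exp (- (z * of_real x)))"
    by (rule set_integrable_bound) (auto simp: set_borel_measurable_def mult_ac)
  have "z \<noteq> 0" using assms by auto
  have "((\<lambda>x. exp (- (Re z * x))) \<longlongrightarrow> 0) at_top"
    using assms by real_asymp
  hence "((\<lambda>x. exp (- (z * of_real x))) \<longlongrightarrow> 0) at_top"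
    by (subst tendsto_norm_zero_iff[symmetric]) simp
  hence "((\<lambda>x. - exp (- (z * of_real x)) / z) \<longlongrightarrow> - 0 / z) at_top"
    by (intro tendsto_intros) (use \<open>z \<noteq> 0\<close> in auto)
  moreover have "((\<lambda>x::real. - exp (- (z * of_real x)) / z) \<longlongrightarrow> - exp (- (z * of_real 0)) / z) (at_right 0)"
    by (intro tendsto_intros) (use \<open>z \<noteq> 0\<close> in auto)
  ultimately have "(LBINT x:{0<..}. exp (- (z * of_real x))) = (- 0 / z) - (- exp (- (z * of_real 0)) / z)"
    using \<open>z \<noteq> 0\<close> *
    by (intro halfline_FTC[where F = "\<lambda>x. - exp (- (z * of_real x)) / z"])
       (auto intro!: derivative_eq_intros has_vector_derivative_real_field continuous_intros)
  thus "(LBINT x:{0<..}. exp (- (z * of_real x))) = 1 / z" by simp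
qed

lemma LBINT_exp_halfline_real:
  fixes a :: real
  assumes "a > 0"
  shows "(LBINT x:{0<..}. exp (- (a * x))) = 1 / a"
proof -
  have "complex_of_real (LBINT x:{0<..}. exp (- (a * x))) = (LBINT x:{0<..}. exp (- (of_real a * complex_of_real x)))"
    by (subst set_integral_complex_of_real[symmetric]) (simp add: exp_of_real[symmetric])
  also have "\<dots> = of_real (1 / a)" using LBINT_exp_halfline[of "of_real a"] assms by simp
  finally show ?thesis by (simp only: of_real_eq_iff)
qed

text \<open>
  The integrand is the imaginary part of a complex exponential, so \<open>LBINT_exp_halfline\<close>
  applies with \<open>z = w - \<i>x\<close>. The shift \<open>s\<close> is kept because \<open>s = 0\<close> yields the Poisson-type kernel of the
  Nevanlinna integral, while the sum of the cases \<open>s\<close> and \<open>-s\<close> yields the cosine transform.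
\<close>

lemma LBINT_exp_sin_halfline:
  fixes w s x :: real
  assumes "w > 0"
  shows "set_integrable lborel {0<..} (\<lambda>t. exp (- (w * t)) * sin ((t + s) * x))" (is ?I)
    and "(LBINT t:{0<..}. exp (- (w * t)) * sin ((t + s) * x)) = (w * sin (s * x) + x * cos (s * x)) / (w\<^sup>2 + x\<^sup>2)"
proof -
  define z where "z = Complex w (- x)"
  have z: "Re z > 0" using assms by (simp add: z_def)
  have nz: "w\<^sup>2 + x\<^sup>2 \<noteq> 0"
    using assms by (simp add: sum_power2_eq_zero_iff)
  have eq: "exp (- (w * t)) * sin ((t + s) * x) = Im (cis (s * x) * exp (- (z * of_real t)))" for t
  proof -
    have "cis (s * x) * exp (- (z * of_real t)) = exp (of_real (- (w * t))) * cis ((t + s) * x)"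
      unfolding cis_conv_exp exp_add[symmetric]
      by (rule arg_cong[where f = exp]) (simp add: z_def complex_eq_iff algebra_simps)
    hence "Im (cis (s * x) * exp (- (z * of_real t))) = Im (of_real (exp (- (w * t))) * cis ((t + s) * x))"
      by (simp only: exp_of_real)
    thus ?thesis by simp
  qed
  have int: "set_integrable lborel {0<..} (\<lambda>t. cis (s * x) * exp (- (z * of_real t)))"
    by (intro set_integrable_mult_right set_integrable_exp_halfline z)
  show ?I unfolding eq using int unfolding set_integrable_def scaleR_conv_of_real
    by (auto dest: integrable_Im simp: )
  have "(LBINT t:{0<..}. exp (- (w * t)) * sin ((t + s) * x)) =
      Im (LBINT t:{0<..}. cis (s * x) * exp (- (z * of_real t)))"
    unfolding eq set_lebesgue_integral_def using int
    by (subst integral_Im[symmetric]) (auto simp: set_integrable_def)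
  also have "\<dots> = Im (cis (s * x) / z)"
    by (simp add: LBINT_exp_halfline[OF z])
  also have "\<dots> = (w * sin (s * x) + x * cos (s * x)) / (w\<^sup>2 + x\<^sup>2)"
    using nz by (simp add: z_def Im_divide field_simps)
  finally show "(LBINT t:{0<..}. exp (- (w * t)) * sin ((t + s) * x)) = \<dots>" .
qed

text \<open>
  A majorant of product form makes the double integral absolutely convergent; every exchange of
  integrals below is of this kind.
\<close>

lemma Fubini_dominated:
  fixes f :: "'a \<Rightarrow> 'b \<Rightarrow> 'c::{banach, second_countable_topology}"
  assumes "sigma_finite_measure M1" "sigma_finite_measure M2"
    and meas: "case_prod f \<in> borel_measurable (M1 \<Otimes>\<^sub>M M2)"
    and h1: "integrable M1 h1" and h2: "integrable M2 h2"
    and bound: "\<And>x y. norm (f x y) \<le> h1 x * (h2 y :: real)"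
  shows "(\<integral>y. (\<integral>x. f x y \<partial>M1) \<partial>M2) = (\<integral>x. (\<integral>y. f x y \<partial>M2) \<partial>M1)"
    and "integrable M2 (\<lambda>y. \<integral>x. f x y \<partial>M1)" "integrable M1 (\<lambda>x. \<integral>y. f x y \<partial>M2)"
proof -
  interpret M1: sigma_finite_measure M1 by fact
  interpret M2: sigma_finite_measure M2 by fact
  interpret pair_sigma_finite M1 M2 ..
  have [measurable]: "h1 \<in> borel_measurable M1" "h2 \<in> borel_measurable M2"
    using h1 h2 by auto
  have "integrable (M1 \<Otimes>\<^sub>M M2) (\<lambda>(x, y). h1 x * h2 y)"
    by (rule Fubini_integrable) (use h1 h2 in \<open>auto simp: abs_mult\<close>)
  hence int: "integrable (M1 \<Otimes>\<^sub>M M2) (case_prod f)"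
    by (rule Bochner_Integration.integrable_bound[OF _ meas])
       (auto intro!: AE_I2 order_trans[OF bound] simp flip: abs_mult)
  show "(\<integral>y. (\<integral>x. f x y \<partial>M1) \<partial>M2) = (\<integral>x. (\<integral>y. f x y \<partial>M2) \<partial>M1)"
    by (rule Fubini_integral[OF int])
  show "integrable M2 (\<lambda>y. \<integral>x. f x y \<partial>M1)" by (rule integrable_snd[OF int])
  show "integrable M1 (\<lambda>x. \<integral>y. f x y \<partial>M2)" by (rule integrable_fst[OF int])
qed

lemma set_integrable_exp_halfline_real: "w > 0 \<Longrightarrow> set_integrable lborel {0<..} (\<lambda>t::real. exp (- (w * t)))"
  using integrable_I0i_exp_mscale[of w] by (simp add: mult.commute)

text \<open>
  The linear factor is absorbed by half of the exponential decay.
\<close>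

lemma set_integrable_affine_exp_halfline:
  assumes "w > 0"
  shows "set_integrable lborel {0<..} (\<lambda>t::real. exp (- (w * t)) * \<bar>t + s\<bar>)"
proof -
  have "set_integrable lborel {0<..} (\<lambda>t. (2 / w) * exp (- (w / 2 * t)) + exp (- (w * t)) * \<bar>s\<bar>)"
    using assms by (intro set_integral_add set_integrable_mult_right set_integrable_mult_left set_integrable_exp_halfline_real) auto
  thus ?thesis
  proof (rule set_integrable_bound)
    have "exp (- (w * t)) * \<bar>t + s\<bar> \<le> (2 / w) * exp (- (w / 2 * t)) + exp (- (w * t)) * \<bar>s\<bar>" if "t > 0" for t
    proof -
      have "t \<le> (2 / w) * exp (w / 2 * t)"
        using exp_ge_add_one_self[of "w / 2 * t"] assms by (simp add: field_simps)
      hence "exp (- (w * t)) * t \<le> exp (- (w * t)) * ((2 / w) * exp (w / 2 * t))"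
        by (intro mult_left_mono) auto
      also have "\<dots> = (2 / w) * exp (- (w / 2 * t))"
        by (simp add: exp_add[symmetric] field_simps)
      finally have "exp (- (w * t)) * t \<le> (2 / w) * exp (- (w / 2 * t))" .
      moreover have "exp (- (w * t)) * \<bar>t + s\<bar> \<le> exp (- (w * t)) * (t + \<bar>s\<bar>)"
        using that by (intro mult_left_mono) auto
      ultimately show ?thesis by (simp add: distrib_left)
    qed
    thus "AE t in lborel. t \<in> {0<..} \<longrightarrow> norm (exp (- (w * t)) * \<bar>t + s\<bar>)
        \<le> norm ((2 / w) * exp (- (w / 2 * t)) + exp (- (w * t)) * \<bar>s\<bar>)"
      by (intro AE_I2) (force simp: abs_mult)
  qed (auto simp: set_borel_measurable_def)
qed

lemma LBINT_symmetrize: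
  fixes f :: "real \<Rightarrow> 'a::{banach, second_countable_topology}"
  assumes "integrable lborel f"
  shows "(LBINT x. f x) = (LBINT x:{0<..}. f x + f (- x))"
proof -
  note [measurable] = borel_measurable_integrable[OF assms]
  have refl: "integrable lborel (\<lambda>x. f (- x))"
    using lborel_integrable_real_affine[OF assms, of "-1" 0] by simp
  have "(LBINT x. f x) = (LBINT x. indicator {0<..} x *\<^sub>R f x + indicator {..<0} x *\<^sub>R f x)"
    using AE_lborel_singleton[of 0] by (intro integral_cong_AE) (auto simp: indicator_def)
  also have "\<dots> = (LBINT x. indicator {0<..} x *\<^sub>R f x) + (LBINT x. indicator {..<0} x *\<^sub>R f x)"
    by (intro Bochner_Integration.integral_add integrable_mult_indicator assms) auto
  also have "(LBINT x. indicator {..<0} x *\<^sub>R f x) = (LBINT x. indicator {0<..} x *\<^sub>R f (- x))"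
    by (subst lborel_integral_real_affine[where c = "-1" and t = 0]) (auto simp: indicator_def)
  also have "(LBINT x. indicator {0<..} x *\<^sub>R f x) + (LBINT x. indicator {0<..} x *\<^sub>R f (- x))
      = (LBINT x. indicator {0<..} x *\<^sub>R (f x + f (- x)))"
    unfolding scaleR_add_right
    by (intro Bochner_Integration.integral_add[symmetric] integrable_mult_indicator assms refl) auto
  finally show ?thesis by (simp add: set_lebesgue_integral_def)
qed

lemma LBINT_Ici_eq_Ioi:
  fixes f :: "real \<Rightarrow> real"
  assumes [measurable]: "f \<in> borel_measurable borel"
  shows "(LBINT u:{s..}. f u) = (LBINT u:{s<..}. f u)"
  unfolding set_lebesgue_integral_def
  using AE_lborel_singleton[of s] by (intro integral_cong_AE) (auto simp: indicator_def)

section \<open>Partial fractions of the hyperbolic cotangent\<close>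

text \<open>
  The Langevin function. As \<open>1 / 0 = 0\<close>, its value at \<open>0\<close> is \<open>0\<close>, in accordance with its continuous
  extension.
\<close>

definition langevin :: "real \<Rightarrow> real" where
  "langevin u = cosh u / sinh u - 1 / u"

lemma langevin_minus: "langevin (- u) = - langevin u"
  by (simp add: langevin_def)

text \<open>
  The logarithmic derivative of Euler's reflection formula
  \<open>\<Gamma>(z) \<Gamma>(1 - z) = \<pi> / sin (\<pi>z)\<close>.
\<close>

lemma Digamma_reflection_complex:
  assumes "(z::complex) \<notin> \<int>"
  shows "Digamma (1 - z) - Digamma z = of_real pi * cos (of_real pi * z) / sin (of_real pi * z)"
proof -
  have nz: "z \<notin> \<int>\<^sub>\<le>\<^sub>0" "1 - z \<notin> \<int>\<^sub>\<le>\<^sub>0"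
    using assms nonpos_Ints_Int Ints_diff[of 1 "1 - z"] by auto
  have s: "sin (of_real pi * z) \<noteq> 0"
  proof
    assume "sin (of_real pi * z) = 0"
    then obtain n :: int where "of_real pi * z = of_real (n * pi)"
      by (auto simp: sin_eq_0)
    hence "z = of_int n" by simp
    thus False using assms by auto
  qed
  have "((\<lambda>z. Gamma z * Gamma (1 - z)) has_field_derivative
      (Gamma z * Gamma (1 - z) * (Digamma z - Digamma (1 - z)))) (at z)"
    using nz by (auto intro!: derivative_eq_intros simp: algebra_simps)
  moreover have "((\<lambda>z::complex. of_real pi / sin (of_real pi * z)) has_field_derivative
      (- (of_real pi / sin (of_real pi * z)) * (of_real pi * cos (of_real pi * z) / sin (of_real pi * z)))) (at z)"
    using s by (auto intro!: derivative_eq_intros simp: field_simps)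
  ultimately have "of_real pi / sin (of_real pi * z) * (Digamma z - Digamma (1 - z)) =
     of_real pi / sin (of_real pi * z) * - (of_real pi * cos (of_real pi * z) / sin (of_real pi * z))"
    by (simp add: Gamma_reflection_complex DERIV_unique)
  hence "Digamma z - Digamma (1 - z) = - (of_real pi * cos (of_real pi * z) / sin (of_real pi * z))"
    using s by (subst (asm) mult_left_cancel) auto
  thus ?thesis by (simp add: algebra_simps)
qed

text \<open>
  On the imaginary axis the cotangent in the reflection formula of the digamma function becomes a
  hyperbolic cotangent, and the series of \<open>\<psi>(1 - z)\<close> and \<open>\<psi>(1 + z)\<close> with \<open>z = \<i>u/\<pi>\<close> combine
  to the stated one, in which the pole of \<open>coth\<close> at \<open>0\<close> has been removed.
\<close>

lemma langevin_partial_fractions: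
  assumes "u \<noteq> 0"
  shows "(\<lambda>n. 2 * u / (u\<^sup>2 + (pi * real (Suc n))\<^sup>2)) sums langevin u"
proof -
  \<comment> \<open>Then \<open>\<pi>z = \<i>u\<close>, and trigonometric functions of it are hyperbolic functions of \<open>u\<close>.\<close>
  define z :: complex where "z = \<i> * of_real (u / pi)"
  have z: "z \<notin> \<int>" "z \<noteq> 0" using assms
    by (auto simp: z_def Ints_def complex_eq_iff)
  have nz: "1 + z \<noteq> 0" "1 - z \<noteq> 0" using assms by (auto simp: z_def complex_eq_iff)
  have "(\<lambda>n. (inverse (of_nat (Suc n)) - inverse (1 - z + of_nat n)) -
             (inverse (of_nat (Suc n)) - inverse (1 + z + of_nat n)))
       sums ((Digamma (1 - z) + euler_mascheroni) - (Digamma (1 + z) + euler_mascheroni))"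
    using summable_Digamma[OF nz(1)] summable_Digamma[OF nz(2)]
    by (intro sums_diff) (auto simp: Digamma_def intro!: summable_sums)
  also have "(Digamma (1 - z) + euler_mascheroni) - (Digamma (1 + z) + euler_mascheroni) =
      of_real pi * cos (of_real pi * z) / sin (of_real pi * z) - 1 / z"
    using Digamma_reflection_complex[OF z(1)] Digamma_plus1[OF z(2)] by (simp add: algebra_simps)
  also have "\<dots> = - \<i> * of_real (pi * langevin u)"
  proof -
    have "of_real pi * z = \<i> * of_real u" by (simp add: z_def)
    moreover have "cos (\<i> * of_real u) = of_real (cosh u)" "sin (\<i> * of_real u) = \<i> * of_real (sinh u)"
      by (simp_all add: cos_i_times sin_i_times cosh_field_def sinh_field_def exp_minus flip: exp_of_real)
    ultimately show ?thesis using assms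
      by (simp add: z_def langevin_def field_simps)
  qed
  finally have "(\<lambda>n. inverse (1 + z + of_nat n) - inverse (1 - z + of_nat n)) sums (- \<i> * of_real (pi * langevin u))"
    by simp
  from sums_mult[OF this, of "\<i> / of_real pi"]
  have *: "(\<lambda>n. \<i> / of_real pi * (inverse (1 + z + of_nat n) - inverse (1 - z + of_nat n))) sums
     of_real (langevin u)" by (simp add: field_simps)
  have "\<i> / of_real pi * (inverse (1 + z + of_nat n) - inverse (1 - z + of_nat n)) =
     of_real (2 * u / (u\<^sup>2 + (pi * real (Suc n))\<^sup>2))" for n
  proof -
    have a: "1 + z + of_nat n \<noteq> 0" "1 - z + of_nat n \<noteq> 0"
      using assms by (auto simp: z_def complex_eq_iff)
    have "\<i> / of_real pi * (inverse (1 + z + of_nat n) - inverse (1 - z + of_nat n)) =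
       \<i> / of_real pi * (- 2 * z) / ((of_nat (Suc n))\<^sup>2 - z\<^sup>2)"
    proof -
      have "(of_nat (Suc n))\<^sup>2 - z\<^sup>2 = (1 + z + of_nat n) * (1 - z + of_nat n)"
        by (simp add: algebra_simps power2_eq_square)
      thus ?thesis using a by (simp add: divide_simps)
    qed
    also have "(of_nat (Suc n))\<^sup>2 - z\<^sup>2 = of_real ((real (Suc n))\<^sup>2 + (u / pi)\<^sup>2)"
      by (simp add: z_def power_mult_distrib power_divide)
    also have "\<i> / of_real pi * (- 2 * z) = of_real (2 * u / pi\<^sup>2)"
      by (simp add: z_def power2_eq_square field_simps)
    also have "of_real (2 * u / pi\<^sup>2) / of_real ((real (Suc n))\<^sup>2 + (u / pi)\<^sup>2) =
       complex_of_real (2 * u / (pi\<^sup>2 * ((real (Suc n))\<^sup>2 + (u / pi)\<^sup>2)))"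
      by simp
    also have "pi\<^sup>2 * ((real (Suc n))\<^sup>2 + (u / pi)\<^sup>2) = u\<^sup>2 + (pi * real (Suc n))\<^sup>2"
      by (simp only: power_divide power_mult_distrib distrib_left) simp
    finally show ?thesis .
  qed
  with * have "(\<lambda>n. complex_of_real (2 * u / (u\<^sup>2 + (pi * real (Suc n))\<^sup>2))) sums of_real (langevin u)"
    by (simp only: )
  thus ?thesis by (simp only: sums_of_real_iff)
qed

section \<open>The sine transform of the Bose weight\<close>

text \<open>The Bose--Einstein distribution at inverse temperature \<open>\<pi>\<close>.\<close>

definition bose :: "real \<Rightarrow> real" where "bose x = 1 / (exp (pi * x) - 1)"

lemma bose_pos: "x > 0 \<Longrightarrow> bose x > 0" by (simp add: bose_def)

lemma measurable_bose [measurable]: "bose \<in> borel_measurable borel"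
  unfolding bose_def by measurable

lemma measurable_sinh_cosh [measurable]:
  "cosh \<in> borel_measurable (borel :: real measure)" "sinh \<in> borel_measurable (borel :: real measure)"
  by (auto intro!: borel_measurable_continuous_onI continuous_on_cosh continuous_on_sinh continuous_on_id)

lemma measurable_langevin [measurable]: "langevin \<in> borel_measurable borel"
  unfolding langevin_def by measurable

text \<open>
  With \<open>E = exp (\<pi>x/2)\<close> one has \<open>exp (\<pi>x) - 1 = (E - 1)(E + 1) \<ge> (\<pi>x/2) E\<close>, which bounds the
  integrand both at the singularity \<open>0\<close> of the Bose weight and at infinity.
\<close>

lemma set_integrable_id_bose: "set_integrable lborel {0<..} (\<lambda>x. x * bose x)"
proof -
  have "set_integrable lborel {0<..} (\<lambda>x. (2 / pi) * exp (- (pi / 2 * x)))"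
    by (intro set_integrable_mult_right set_integrable_exp_halfline_real) auto
  thus ?thesis
  proof (rule set_integrable_bound)
    have "x * bose x \<le> (2 / pi) * exp (- (pi / 2 * x))" if "x > 0" for x
    proof -
      define E where "E = exp (pi / 2 * x)"
      have E: "E \<ge> 1 + pi / 2 * x" unfolding E_def by (rule exp_ge_add_one_self)
      have "pi / 2 * x * E \<le> (E - 1) * (E + 1)"
      proof (rule mult_mono)
        show "pi / 2 * x \<le> E - 1" using E by linarith
        show "E \<le> E + 1" "0 \<le> E" by (simp_all add: E_def)
        show "0 \<le> E - 1" using E mult_pos_pos[OF pi_gt_zero that] by linarith
      qed
      also have "\<dots> = exp (pi * x) - 1"
        by (simp add: E_def algebra_simps exp_add[symmetric])
      finally have *: "pi / 2 * x * E \<le> exp (pi * x) - 1" .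
      have pos: "exp (pi * x) - 1 > 0" "E > 0" using that by (auto simp: E_def)
      have "x * bose x \<le> (2 / pi) * (1 / E)"
        using * pos by (simp add: bose_def field_simps)
      also have "1 / E = exp (- (pi / 2 * x))" by (simp only: E_def exp_minus inverse_eq_divide)
      finally show ?thesis .
    qed
    thus "AE x in lborel. x \<in> {0<..} \<longrightarrow> norm (x * bose x) \<le> norm ((2 / pi) * exp (- (pi / 2 * x)))"
      by (intro AE_I2) (use bose_pos in \<open>force simp: abs_mult\<close>)
  qed (auto simp: set_borel_measurable_def)
qed

lemma bose_sums:
  assumes "x > 0"
  shows "(\<lambda>n. exp (- (pi * real (Suc n) * x))) sums bose x"
proof -
  define q where "q = exp (- (pi * x))"
  have q: "0 < q" "q < 1" using assms by (auto simp: q_def)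
  have "(\<lambda>n. q * q ^ n) sums (q * (1 / (1 - q)))"
    by (intro sums_mult geometric_sums) (use q in auto)
  moreover have "q * q ^ n = exp (- (pi * real (Suc n) * x))" for n
    unfolding q_def exp_of_nat_mult[symmetric] exp_add[symmetric]
    by (rule arg_cong[where f = exp]) (simp add: algebra_simps)
  moreover have "q * (1 / (1 - q)) = bose x"
    using assms by (simp add: q_def bose_def exp_minus field_simps)
  ultimately show ?thesis by simp
qed

text \<open>
  Expand the weight into the geometric series \<open>\<Sum>n\<ge>1. exp (-n\<pi>x)\<close>. Termwise, the sine transform of
  \<open>exp (-n\<pi>x)\<close> is \<open>u / (u\<^sup>2 + n\<^sup>2\<pi>\<^sup>2)\<close>, so that the partial fraction expansion sums up the result. The
  partial sums are dominated by \<open>\<bar>u\<bar> x bose x\<close> because \<open>\<bar>sin (u x)\<bar> \<le> \<bar>u\<bar> x\<close>.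
\<close>

lemma sine_transform_bose:
  "(LBINT x:{0<..}. bose x * sin (u * x)) = langevin u / 2"
proof (cases "u = 0")
  case False
  define S where "S = (\<lambda>N x. \<Sum>n<N. exp (- (pi * real (Suc n) * x)) * sin (u * x))"
  have lim1: "(\<lambda>N. LBINT x:{0<..}. S N x) \<longlonglongrightarrow> (LBINT x:{0<..}. bose x * sin (u * x))"
    unfolding set_lebesgue_integral_def
  proof (rule integral_dominated_convergence)
    show "integrable lborel (\<lambda>x. indicator {0<..} x *\<^sub>R (x * bose x) * \<bar>u\<bar>)"
      using set_integrable_id_bose by (simp add: set_integrable_def)
    show "AE x in lborel. (\<lambda>N. indicator {0<..} x *\<^sub>R S N x) \<longlonglongrightarrow> indicator {0<..} x *\<^sub>R (bose x * sin (u * x))"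
      unfolding S_def sum_distrib_right[symmetric]
      by (intro AE_I2) (use bose_sums in \<open>auto simp: sums_def indicator_def intro!: tendsto_mult\<close>)
    show "AE x in lborel. norm (indicator {0<..} x *\<^sub>R S N x) \<le> indicator {0<..} x *\<^sub>R (x * bose x) * \<bar>u\<bar>" for N
    proof (intro AE_I2)
      fix x :: real
      show "norm (indicator {0<..} x *\<^sub>R S N x) \<le> indicator {0<..} x *\<^sub>R (x * bose x) * \<bar>u\<bar>"
      proof (cases "x > 0")
        case True
        have "(\<Sum>n<N. exp (- (pi * real (Suc n) * x))) \<le> bose x"
          using bose_sums[OF True] by (metis exp_ge_zero sum_le_suminf sums_iff finite_lessThan)
        moreover have "\<bar>sin (u * x)\<bar> \<le> \<bar>u\<bar> * x"
          using abs_sin_x_le_abs_x[of "u * x"] True by (simp add: abs_mult)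
        ultimately have "(\<Sum>n<N. exp (- (pi * real (Suc n) * x))) * \<bar>sin (u * x)\<bar> \<le> bose x * (\<bar>u\<bar> * x)"
          using True bose_pos[OF True] by (intro mult_mono) auto
        moreover have "\<bar>S N x\<bar> = (\<Sum>n<N. exp (- (pi * real (Suc n) * x))) * \<bar>sin (u * x)\<bar>"
          by (simp only: S_def sum_distrib_right[symmetric] abs_mult) (simp add: sum_nonneg)
        ultimately show ?thesis using True by (simp add: mult_ac)
      qed auto
    qed
  qed (auto simp: S_def)
  have eq: "(LBINT x:{0<..}. S N x) = (\<Sum>n<N. (2 * u / (u\<^sup>2 + (pi * real (Suc n))\<^sup>2)) / 2)" for N
  proof -
    have "(LBINT x:{0<..}. S N x) = (\<Sum>n<N. LBINT x:{0<..}. exp (- (pi * real (Suc n) * x)) * sin (u * x))"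
      unfolding S_def set_lebesgue_integral_def scaleR_sum_right
    proof (rule Bochner_Integration.integral_sum)
      fix n
      show "integrable lborel (\<lambda>x. indicat_real {0<..} x *\<^sub>R (exp (- (pi * real (Suc n) * x)) * sin (u * x)))"
        using LBINT_exp_sin_halfline(1)[of "pi * real (Suc n)" 0 u]
        by (simp add: set_integrable_def mult.commute[of u])
    qed
    also have "\<dots> = (\<Sum>n<N. (2 * u / (u\<^sup>2 + (pi * real (Suc n))\<^sup>2)) / 2)"
    proof (rule sum.cong[OF refl])
      fix n
      have half: "(2 * u / d) / 2 = u / d" for d by simp
      show "(LBINT x:{0<..}. exp (- (pi * real (Suc n) * x)) * sin (u * x)) = (2 * u / (u\<^sup>2 + (pi * real (Suc n))\<^sup>2)) / 2"
        using LBINT_exp_sin_halfline(2)[of "pi * real (Suc n)" 0 u]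
        unfolding half by (simp add: mult.commute[of u] add.commute)
    qed
    finally show ?thesis .
  qed
  have lim2: "(\<lambda>N. \<Sum>n<N. (2 * u / (u\<^sup>2 + (pi * real (Suc n))\<^sup>2)) / 2) \<longlonglongrightarrow> langevin u / 2"
    using sums_divide[OF langevin_partial_fractions[OF False], of 2] by (simp add: sums_def)
  show ?thesis by (rule LIMSEQ_unique[OF lim1[unfolded eq] lim2])
qed (simp add: langevin_def)

text \<open>
  The bridge between the two sides of the theory: both sides are the double integral of
  \<open>bose x * exp (-w t) * sin ((t + s) x)\<close>, integrated first over \<open>x\<close> (sine transform) or first over
  \<open>t\<close> (elementary).
\<close>

lemma Laplace_langevin_shift:
  assumes "w > 0"
  shows "set_integrable lborel {0<..} (\<lambda>t. exp (- (w * t)) * langevin (t + s))"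
    and "set_integrable lborel {0<..} (\<lambda>x. bose x * ((w * sin (s * x) + x * cos (s * x)) / (w\<^sup>2 + x\<^sup>2)))"
    and "(LBINT t:{0<..}. exp (- (w * t)) * langevin (t + s)) =
         2 * (LBINT x:{0<..}. bose x * ((w * sin (s * x) + x * cos (s * x)) / (w\<^sup>2 + x\<^sup>2)))"
proof -
  define f where "f = (\<lambda>x t::real. indicator {0<..} x * indicator {0<..} t * (bose x * (exp (- (w * t)) * sin ((t + s) * x))))"
  define h1 where "h1 = (\<lambda>x. indicator {0<..} x * (x * bose x))"
  define h2 where "h2 = (\<lambda>t. indicator {0<..} t * (exp (- (w * t)) * \<bar>t + s\<bar>))"
  have h: "integrable lborel h1" "integrable lborel h2"
    using set_integrable_id_bose set_integrable_affine_exp_halfline[OF assms]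
    by (auto simp: set_integrable_def h1_def h2_def)
  have meas: "case_prod f \<in> borel_measurable (lborel \<Otimes>\<^sub>M lborel)"
    unfolding f_def by measurable
  have bound: "norm (f x t) \<le> h1 x * h2 t" for x t
  proof (cases "x > 0 \<and> t > 0")
    case True
    have "\<bar>sin ((t + s) * x)\<bar> \<le> \<bar>t + s\<bar> * x"
      using abs_sin_x_le_abs_x[of "(t + s) * x"] True by (simp add: abs_mult)
    hence "(bose x * exp (- (w * t))) * \<bar>sin ((t + s) * x)\<bar> \<le> (bose x * exp (- (w * t))) * (\<bar>t + s\<bar> * x)"
      using bose_pos[of x] True by (intro mult_left_mono) auto
    thus ?thesis using True bose_pos[of x] by (simp add: f_def h1_def h2_def abs_mult mult_ac)
  qed (auto simp: f_def h1_def h2_def)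
  note Fub = Fubini_dominated[OF lborel.sigma_finite_measure_axioms lborel.sigma_finite_measure_axioms meas h bound]
  have inner_x: "(LBINT x. f x t) = indicator {0<..} t * (exp (- (w * t)) * (langevin (t + s) / 2))" for t
  proof -
    have "(LBINT x. f x t) = (LBINT x. (indicator {0<..} t * exp (- (w * t))) * (indicator {0<..} x * (bose x * sin ((t + s) * x))))"
      by (simp add: f_def mult_ac)
    also have "\<dots> = (indicator {0<..} t * exp (- (w * t))) * (langevin (t + s) / 2)"
      using sine_transform_bose[of "t + s"]
      by (simp only: integral_mult_right_zero set_lebesgue_integral_def real_scaleR_def)
    finally show ?thesis by simp
  qed
  have inner_t: "(LBINT t. f x t) = indicator {0<..} x * (bose x * ((w * sin (s * x) + x * cos (s * x)) / (w\<^sup>2 + x\<^sup>2)))" for x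
  proof -
    have "(LBINT t. f x t) = (LBINT t. (indicator {0<..} x * bose x) * (indicator {0<..} t * (exp (- (w * t)) * sin ((t + s) * x))))"
      by (simp add: f_def mult_ac)
    also have "\<dots> = (indicator {0<..} x * bose x) * ((w * sin (s * x) + x * cos (s * x)) / (w\<^sup>2 + x\<^sup>2))"
      using LBINT_exp_sin_halfline(2)[OF assms, of s x]
      by (simp only: integral_mult_right_zero set_lebesgue_integral_def real_scaleR_def)
    finally show ?thesis by simp
  qed
  have "set_integrable lborel {0<..} (\<lambda>t. 2 * (exp (- (w * t)) * (langevin (t + s) / 2)))"
    using Fub(2) unfolding inner_x by (intro set_integrable_mult_right) (simp add: set_integrable_def)
  thus "set_integrable lborel {0<..} (\<lambda>t. exp (- (w * t)) * langevin (t + s))" by simp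
  show "set_integrable lborel {0<..} (\<lambda>x. bose x * ((w * sin (s * x) + x * cos (s * x)) / (w\<^sup>2 + x\<^sup>2)))"
    using Fub(3) unfolding inner_t by (simp add: set_integrable_def)
  have "(LBINT t:{0<..}. exp (- (w * t)) * (langevin (t + s) / 2)) =
         (LBINT x:{0<..}. bose x * ((w * sin (s * x) + x * cos (s * x)) / (w\<^sup>2 + x\<^sup>2)))"
    using Fub(1) unfolding inner_x inner_t by (simp add: set_lebesgue_integral_def)
  thus "(LBINT t:{0<..}. exp (- (w * t)) * langevin (t + s)) =
         2 * (LBINT x:{0<..}. bose x * ((w * sin (s * x) + x * cos (s * x)) / (w\<^sup>2 + x\<^sup>2)))"
    by simp
qed

section \<open>The Laplace transform of the Langevin function\<close>

text \<open>
  The integrand is \<open>\<integral> exp (-u t) du\<close> over \<open>[a, b]\<close>; exchanging the integrals leaves \<open>\<integral> du / u\<close>.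
\<close>

lemma Frullani_exp:
  fixes a b :: real
  assumes "0 < a" "a \<le> b"
  shows "set_integrable lborel {0<..} (\<lambda>t. (exp (- (a * t)) - exp (- (b * t))) / t)"
    and "(LBINT t:{0<..}. (exp (- (a * t)) - exp (- (b * t))) / t) = ln b - ln a"
proof -
  define f where "f = (\<lambda>t u::real. indicator {0<..} t * indicator {a..b} u * exp (- (u * t)))"
  define h1 where "h1 = (\<lambda>t::real. indicator {0<..} t * exp (- (a * t)))"
  have h: "integrable lborel h1" "integrable lborel (indicat_real {a..b})"
    using set_integrable_exp_halfline_real[OF assms(1)]
    by (auto simp: set_integrable_def h1_def intro!: integrable_real_indicator simp: emeasure_lborel_Icc_eq)
  have meas: "case_prod f \<in> borel_measurable (lborel \<Otimes>\<^sub>M lborel)"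
    unfolding f_def by measurable
  have bound: "norm (f t u) \<le> h1 t * indicator {a..b} u" for t u
    by (auto simp: f_def h1_def indicator_def)
  note Fub = Fubini_dominated[OF lborel.sigma_finite_measure_axioms lborel.sigma_finite_measure_axioms meas h bound]
  have inner_t: "(LBINT t. f t u) = indicator {a..b} u *\<^sub>R (1 / u)" for u
  proof (cases "u \<in> {a..b}")
    case True
    hence "u > 0" using assms by auto
    thus ?thesis using True LBINT_exp_halfline_real[of u]
      by (simp add: f_def set_lebesgue_integral_def)
  qed (simp add: f_def)
  have inner_u: "(LBINT u. f t u) = indicator {0<..} t *\<^sub>R ((exp (- (a * t)) - exp (- (b * t))) / t)" for t
  proof (cases "t > 0")
    case True
    have "(LBINT u. indicator {a..b} u *\<^sub>R exp (- (u * t))) = - exp (- (b * t)) / t - - exp (- (a * t)) / t"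
      using assms True
      by (intro integral_FTC_atLeastAtMost)
         (auto intro!: derivative_eq_intros continuous_intros simp flip: has_real_derivative_iff_has_vector_derivative)
    thus ?thesis using True by (simp add: f_def diff_divide_distrib)
  qed (simp add: f_def)
  show "set_integrable lborel {0<..} (\<lambda>t. (exp (- (a * t)) - exp (- (b * t))) / t)"
    using Fub(3) unfolding inner_u by (simp add: set_integrable_def)
  have "(LBINT u. indicator {a..b} u *\<^sub>R (1 / u)) = ln b - ln a"
    using assms
    by (intro integral_FTC_atLeastAtMost)
       (auto intro!: derivative_eq_intros continuous_intros simp flip: has_real_derivative_iff_has_vector_derivative simp: field_simps)
  thus "(LBINT t:{0<..}. (exp (- (a * t)) - exp (- (b * t))) / t) = ln b - ln a"
    using Fub(1) unfolding inner_t inner_u set_lebesgue_integral_def by simp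
qed

lemma langevin_exp:
  assumes "t \<noteq> 0"
  shows "langevin t = 2 / (1 - exp (- (2 * t))) - 1 - 1 / t"
proof -
  have "exp t * exp t \<noteq> 1" using assms by (simp add: exp_add[symmetric])
  moreover have "exp (- (2 * t)) = inverse (exp t * exp t)"
    by (simp add: exp_minus exp_add[symmetric])
  ultimately have "cosh t / sinh t = 2 / (1 - exp (- (2 * t))) - 1"
    by (simp add: cosh_field_def sinh_field_def exp_minus field_simps)
  thus ?thesis by (simp add: langevin_def)
qed

text \<open>
  A form of Binet's formula for the digamma function. Multiplying the integrand by \<open>1 - exp (-2mt)\<close>
  turns the denominator \<open>1 - exp (-2t)\<close> of the hyperbolic cotangent into a finite geometric sum, and the
  remaining singular part \<open>1/t\<close> into a Frullani integral. As \<open>m\<close> grows, the resulting expression is the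
  limit \<open>ln m - (\<Sum>n<m. 1 / (w/2 + n))\<close> that defines \<open>\<psi>(w/2)\<close>, up to elementary terms.
\<close>

lemma Laplace_langevin:
  assumes "w > 0"
  shows "(LBINT t:{0<..}. exp (- (w * t)) * langevin t) = ln (w / 2) - Digamma (w / 2) - 1 / w"
proof -
  \<comment> \<open>The factor \<open>1 - exp (-2mt)\<close> tends to \<open>1\<close> and is bounded by \<open>1\<close>.\<close>
  define I where "I = (\<lambda>m. LBINT t:{0<..}. (1 - exp (- (2 * real m * t))) * (exp (- (w * t)) * langevin t))"
  have int: "set_integrable lborel {0<..} (\<lambda>t. exp (- (w * t)) * langevin t)"
    using Laplace_langevin_shift(1)[OF assms, of 0] by simp
  have lim1: "I \<longlonglongrightarrow> (LBINT t:{0<..}. exp (- (w * t)) * langevin t)"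
    unfolding I_def set_lebesgue_integral_def
  proof (rule integral_dominated_convergence)
    show "integrable lborel (\<lambda>t. norm (indicator {0<..} t *\<^sub>R (exp (- (w * t)) * langevin t)))"
      using int by (intro integrable_norm) (simp add: set_integrable_def)
    show "AE t in lborel. (\<lambda>m. indicator {0<..} t *\<^sub>R ((1 - exp (- (2 * real m * t))) * (exp (- (w * t)) * langevin t)))
        \<longlonglongrightarrow> indicator {0<..} t *\<^sub>R (exp (- (w * t)) * langevin t)"
    proof (intro AE_I2)
      fix t :: real
      show "(\<lambda>m. indicator {0<..} t *\<^sub>R ((1 - exp (- (2 * real m * t))) * (exp (- (w * t)) * langevin t)))
        \<longlonglongrightarrow> indicator {0<..} t *\<^sub>R (exp (- (w * t)) * langevin t)"
      proof (cases "t > 0")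
        case True
        hence "(\<lambda>m. 1 - exp (- (2 * real m * t))) \<longlonglongrightarrow> 1" by real_asymp
        from tendsto_mult_right[OF this, of "exp (- (w * t)) * langevin t"] True show ?thesis by simp
      qed simp
    qed
    show "AE t in lborel. norm (indicator {0<..} t *\<^sub>R ((1 - exp (- (2 * real m * t))) * (exp (- (w * t)) * langevin t)))
        \<le> norm (indicator {0<..} t *\<^sub>R (exp (- (w * t)) * langevin t))" for m
    proof (intro AE_I2)
      fix t :: real
      have "t > 0 \<Longrightarrow> \<bar>1 - exp (- (2 * real m * t))\<bar> \<le> 1" by simp
      thus "norm (indicator {0<..} t *\<^sub>R ((1 - exp (- (2 * real m * t))) * (exp (- (w * t)) * langevin t)))
        \<le> norm (indicator {0<..} t *\<^sub>R (exp (- (w * t)) * langevin t))"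
        by (auto simp: indicator_def abs_mult intro!: mult_left_le_one_le)
    qed
  qed auto
  have eq: "I m = (\<Sum>n<m. 1 / (w / 2 + real n)) - (1 / w - 1 / (w + 2 * real m)) - (ln (w + 2 * real m) - ln w)" for m
  proof -
    let ?E = "\<lambda>a t. exp (- (a * t)) :: real"
    have eq: "(1 - ?E (2 * real m) t) * (?E w t * langevin t) =
       (\<Sum>n<m. 2 * ?E (w + 2 * real n) t) - (?E w t - ?E (w + 2 * real m) t) - (?E w t - ?E (w + 2 * real m) t) / t"
      if "t > 0" for t
    proof -
      define q where "q = exp (- (2 * t))"
      have q: "q \<noteq> 1" using that by (simp add: q_def)
      have pow: "?E (w + 2 * real n) t = ?E w t * q ^ n" for n
        unfolding q_def exp_of_nat_mult[symmetric] exp_add[symmetric]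
        by (rule arg_cong[where f = exp]) (simp add: algebra_simps)
      have pow': "?E (2 * real m) t = q ^ m"
        unfolding q_def exp_of_nat_mult[symmetric]
        by (rule arg_cong[where f = exp]) (simp add: algebra_simps)
      have sum: "(\<Sum>n<m. 2 * (?E w t * q ^ n)) = 2 * ?E w t * (1 - q ^ m) / (1 - q)"
        using q by (simp add: sum_gp_strict flip: sum_distrib_left)
      have lan: "langevin t = 2 / (1 - q) - 1 - 1 / t"
        using langevin_exp[of t] that by (simp add: q_def)
      show ?thesis unfolding pow pow' sum lan using q that by (simp add: field_simps)
    qed
    note ints = set_integrable_exp_halfline_real Frullani_exp(1)[OF assms, of "w + 2 * real m"]
    have pos: "w + 2 * real n > 0" for n using assms by simp
    have sum_int: "set_integrable lborel {0<..} (\<lambda>t. \<Sum>n<m. 2 * ?E (w + 2 * real n) t)"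
      unfolding set_integrable_def scaleR_sum_right
      by (intro Bochner_Integration.integrable_sum)
         (use set_integrable_mult_right[OF set_integrable_exp_halfline_real[OF pos], of 2] in \<open>simp add: set_integrable_def\<close>)
    have "I m = (LBINT t:{0<..}. (\<Sum>n<m. 2 * ?E (w + 2 * real n) t) - (?E w t - ?E (w + 2 * real m) t) - (?E w t - ?E (w + 2 * real m) t) / t)"
      unfolding I_def by (intro set_lebesgue_integral_cong) (use eq in auto)
    also have "\<dots> = (LBINT t:{0<..}. (\<Sum>n<m. 2 * ?E (w + 2 * real n) t)) - ((LBINT t:{0<..}. ?E w t) - (LBINT t:{0<..}. ?E (w + 2 * real m) t))
        - (LBINT t:{0<..}. (?E w t - ?E (w + 2 * real m) t) / t)"
      using sum_int ints assms pos
      by (subst set_integral_diff | simp add: set_integral_diff(1))+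
    also have "(LBINT t:{0<..}. (\<Sum>n<m. 2 * ?E (w + 2 * real n) t)) = (\<Sum>n<m. LBINT t:{0<..}. 2 * ?E (w + 2 * real n) t)"
      unfolding set_lebesgue_integral_def scaleR_sum_right
      by (intro Bochner_Integration.integral_sum)
         (use set_integrable_mult_right[OF set_integrable_exp_halfline_real[OF pos], of 2] in \<open>simp add: set_integrable_def\<close>)
    also have "\<dots> = (\<Sum>n<m. 1 / (w / 2 + real n))"
      using LBINT_exp_halfline_real[OF pos] by (simp add: field_simps)
    finally show ?thesis
      using assms pos LBINT_exp_halfline_real Frullani_exp(2)[OF assms, of "w + 2 * real m"] by simp
  qed
  have lim2: "(\<lambda>m. (\<Sum>n<m. 1 / (w / 2 + real n)) - (1 / w - 1 / (w + 2 * real m)) - (ln (w + 2 * real m) - ln w))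
     \<longlonglongrightarrow> ln (w / 2) - Digamma (w / 2) - 1 / w"
  proof -
    have 1: "(\<lambda>m. ln (real m) - (\<Sum>n<m. 1 / (w / 2 + real n))) \<longlonglongrightarrow> Digamma (w / 2)"
      using Digamma_LIMSEQ[of "w / 2"] assms by (simp add: inverse_eq_divide)
    have 2: "(\<lambda>m. ln (real m) - (ln (w + 2 * real m) - ln w) + 1 / (w + 2 * real m) - 1 / w) \<longlonglongrightarrow> ln w - ln 2 - 1 / w"
      using assms by real_asymp
    show ?thesis using tendsto_diff[OF 2 1] assms by (simp add: ln_div algebra_simps)
  qed
  show ?thesis by (rule LIMSEQ_unique[OF lim1 lim2[folded eq]])
qed

section \<open>The cosine transform in terms of the exponential integral\<close>

lemma Laplace_shift:
  fixes g :: "real \<Rightarrow> real"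
  shows "(LBINT t:{0<..}. exp (- t) * g (t + s)) = exp s * (LBINT u:{s<..}. exp (- u) * g u)"
    and "set_integrable lborel {0<..} (\<lambda>t. exp (- t) * g (t + s)) \<Longrightarrow> set_integrable lborel {s<..} (\<lambda>u. exp (- u) * g u)"
proof -
  let ?f = "\<lambda>u. exp s * (indicator {s<..} u *\<^sub>R (exp (- u) * g u))"
  have *: "?f (s + 1 * t) = indicator {0<..} t *\<^sub>R (exp (- t) * g (t + s))" for t
  proof -
    have "exp s * exp (- (s + t)) = exp (- t)" by (simp add: exp_add[symmetric])
    thus ?thesis by (simp add: indicator_def add.commute mult.assoc[symmetric])
  qed
  show "(LBINT t:{0<..}. exp (- t) * g (t + s)) = exp s * (LBINT u:{s<..}. exp (- u) * g u)"
    using lborel_integral_real_affine[of 1 ?f s] unfolding * by (simp add: set_lebesgue_integral_def)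
  show "set_integrable lborel {s<..} (\<lambda>u. exp (- u) * g u)"
    if "set_integrable lborel {0<..} (\<lambda>t. exp (- t) * g (t + s))"
    using that lborel_integrable_real_affine_iff[of 1 ?f s] unfolding * by (simp add: set_integrable_def)
qed

lemma set_integrable_exp_langevin: "set_integrable lborel {s<..} (\<lambda>u. exp (- u) * langevin u)"
proof (rule Laplace_shift(2))
  show "set_integrable lborel {0<..} (\<lambda>t. exp (- t) * langevin (t + s))"
    using Laplace_langevin_shift(1)[of 1 s] by simp
qed

lemma set_integrable_exp_div:
  assumes "s > 0"
  shows "set_integrable lborel {s..} (\<lambda>u::real. exp (- u) / u)"
proof -
  have "set_integrable lborel {s..} (\<lambda>u::real. exp (- u) * (1 / s))"
    using set_integrable_subset[OF set_integrable_exp_halfline_real[of 1], of "{s..}"] assms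
    by (intro set_integrable_mult_left) (auto simp: subset_eq)
  thus ?thesis
    by (rule set_integrable_bound)
       (use assms in \<open>auto simp: set_borel_measurable_def intro!: AE_I2 divide_left_mono\<close>)
qed

text \<open>
  Since \<open>exp (-u) coth u = 1 / sinh u - exp (-u)\<close>, the hyperbolic cotangent part has the elementary
  antiderivative \<open>ln (tanh (u/2)) + exp (-u)\<close>, where
  \<open>tanh (u/2) = (1 - exp (-u)) / (1 + exp (-u))\<close>; the part \<open>exp (-u) / u\<close> gives the exponential
  integral at a negative argument.
\<close>

lemma langevin_tail:
  assumes "s > 0"
  shows "(LBINT u:{s<..}. exp (- u) * langevin u) =
     Ei (- s) + ln ((1 + exp (- s)) / (1 - exp (- s))) - exp (- s)"
proof -
  \<comment> \<open>Adding \<open>1/u\<close> keeps only the hyperbolic cotangent.\<close>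
  define G where "G = (\<lambda>u. exp (- u) * (langevin u + 1 / u))"
  have i1: "set_integrable lborel {s<..} (\<lambda>u. exp (- u) / u)"
    using set_integrable_exp_div[OF assms] by (rule set_integrable_subset) auto
  have G_int: "set_integrable lborel {s<..} G"
    using set_integral_add(1)[OF set_integrable_exp_langevin[of s] i1]
    by (simp add: G_def distrib_left)
  have G_eq: "G u = exp (- u) * (cosh u / sinh u)" if "u > 0" for u
    by (simp add: G_def langevin_def)
  have G_deriv: "((\<lambda>u. ln (1 - exp (- u)) - ln (1 + exp (- u)) + exp (- u)) has_real_derivative G u) (at u)"
    if "u > 0" for u
  proof -
    define q where "q = exp (- u)"
    have q: "0 < q" "q < 1" using that by (auto simp: q_def)
    have "exp (- (2 * u)) = q * q" by (simp add: q_def exp_add[symmetric])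
    hence G: "G u = q * (2 / (1 - q * q) - 1)"
      using langevin_exp[of u] that by (simp add: G_def q_def)
    have "q / (1 - q) + q / (1 + q) = (q * (1 + q) + q * (1 - q)) / ((1 - q) * (1 + q))"
      using q by (intro add_frac_eq) auto
    also have "(1 - q) * (1 + q) = 1 - q * q" by (simp add: algebra_simps)
    also have "q * (1 + q) + q * (1 - q) = q * 2" by (simp add: algebra_simps)
    finally have eq: "q / (1 - q) + q / (1 + q) - q = G u"
      unfolding G by (simp add: right_diff_distrib)
    have "((\<lambda>u. ln (1 - exp (- u)) - ln (1 + exp (- u)) + exp (- u)) has_real_derivative (q / (1 - q) + q / (1 + q) - q)) (at u)"
      unfolding q_def using that
      by (auto intro!: derivative_eq_intros simp: add_pos_pos)
    thus ?thesis by (simp only: eq)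
  qed
  have G_cont: "isCont G u" if "u > 0" for u
  proof -
    have "isCont (\<lambda>u. exp (- u) * (cosh u / sinh u)) u"
      using that by (intro continuous_intros) auto
    moreover have "\<forall>\<^sub>F u in nhds u. G u = exp (- u) * (cosh u / sinh u)"
      using eventually_nhds_in_open[of "{0<..}" u] that by (auto elim!: eventually_mono simp: G_eq)
    ultimately show ?thesis by (subst isCont_cong) auto
  qed
  have "(LBINT u:{s<..}. G u) = 0 - (ln (1 - exp (- s)) - ln (1 + exp (- s)) + exp (- s))"
  proof (rule halfline_FTC[where F = "\<lambda>u. ln (1 - exp (- u)) - ln (1 + exp (- u)) + exp (- u)"])
    show "((\<lambda>u. ln (1 - exp (- u)) - ln (1 + exp (- u)) + exp (- u)) has_vector_derivative G x) (at x)" if "x > s" for x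
      using G_deriv[of x] that assms by (simp add: has_real_derivative_iff_has_vector_derivative)
    show "((\<lambda>u. ln (1 - exp (- u)) - ln (1 + exp (- u)) + exp (- u)) \<longlongrightarrow> ln (1 - exp (- s)) - ln (1 + exp (- s)) + exp (- s)) (at_right s)"
      using DERIV_isCont[OF G_deriv[OF assms]] unfolding isCont_def by (rule tendsto_mono[OF at_le, rotated]) auto
    show "((\<lambda>u::real. ln (1 - exp (- u)) - ln (1 + exp (- u)) + exp (- u)) \<longlongrightarrow> 0) at_top"
      by real_asymp
  qed (use G_cont G_int assms in auto)
  moreover have "(LBINT u:{s<..}. G u) = (LBINT u:{s<..}. exp (- u) * langevin u) + (LBINT u:{s<..}. exp (- u) / u)"
    using set_integral_add(2)[OF set_integrable_exp_langevin[of s] i1]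
    by (simp add: G_def distrib_left)
  moreover have "(LBINT u:{s<..}. exp (- u) / u) = - Ei (- s)"
    using assms by (simp add: Ei_def LBINT_Ici_eq_Ioi)
  moreover have "ln ((1 + exp (- s)) / (1 - exp (- s))) = ln (1 + exp (- s)) - ln (1 - exp (- s))"
    using assms by (intro ln_divide_pos) (auto intro: add_pos_pos)
  ultimately show ?thesis by linarith
qed

text \<open>
  The upper bound says that the Langevin function is nonnegative, which is evident from its partial
  fractions.
\<close>

lemma sinh_div_bounds:
  fixes u :: real
  assumes "u > 0"
  shows "0 \<le> sinh u / u" "sinh u / u \<le> cosh u"
proof -
  show "0 \<le> sinh u / u" using assms by (intro divide_nonneg_nonneg) auto
  have "0 \<le> langevin u"
  proof (rule sums_le[OF _ sums_zero])
    show "(\<lambda>n. 2 * u / (u\<^sup>2 + (pi * real (Suc n))\<^sup>2)) sums langevin u"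
      using assms by (intro langevin_partial_fractions) auto
  qed (use assms in auto)
  thus "sinh u / u \<le> cosh u" using assms by (simp add: langevin_def field_simps)
qed

lemma set_integrable_sinh_div: "set_integrable lborel {0<..s} (\<lambda>u::real. sinh u / u)"
proof -
  have "set_integrable lborel {0..s} (cosh :: real \<Rightarrow> real)"
    by (intro borel_integrable_atLeastAtMost' continuous_on_cosh continuous_on_id)
  hence "set_integrable lborel {0<..s} (cosh :: real \<Rightarrow> real)"
    by (rule set_integrable_subset) auto
  thus ?thesis
    by (rule set_integrable_bound)
       (use sinh_div_bounds in \<open>auto simp: set_borel_measurable_def intro!: AE_I2\<close>)
qed

text \<open>
  In the principal value, reflecting the negative half of the domain cancels the singularity at \<open>0\<close>
  and leaves the convergent integral of \<open>(exp u - exp (-u)) / u\<close>.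
\<close>

lemma Ei_pos:
  assumes "s > 0"
  shows "Ei s = Ei (- s) + 2 * (LBINT u:{0<..s}. sinh u / u)"
proof -
  let ?g = "\<lambda>\<epsilon>. (LBINT t:{-s..-\<epsilon>}. exp (- t) / t) + (LBINT t:{\<epsilon>..}. exp (- t) / t)"
  have eq: "?g \<epsilon> = - 2 * (LBINT u:{\<epsilon>..s}. sinh u / u) - Ei (- s)" if \<epsilon>: "0 < \<epsilon>" "\<epsilon> < s" for \<epsilon>
  proof -
    have neg: "(LBINT t:{-s..-\<epsilon>}. exp (- t) / t) = - (LBINT t:{\<epsilon>..s}. exp t / t)"
      unfolding set_lebesgue_integral_def
      by (subst lborel_integral_real_affine[where c = "-1" and t = 0])
         (auto simp: indicator_def simp flip: Bochner_Integration.integral_minus intro!: Bochner_Integration.integral_cong)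
    have int: "set_integrable lborel {\<epsilon>..s} (\<lambda>t. exp t / t)" "set_integrable lborel {\<epsilon>..s} (\<lambda>t. exp (- t) / t)"
      using \<epsilon> by (auto intro!: borel_integrable_atLeastAtMost' continuous_intros)
    have tail: "set_integrable lborel {s<..} (\<lambda>u::real. exp (- u) / u)"
      using set_integrable_exp_div[OF assms] by (rule set_integrable_subset) auto
    have "{\<epsilon>..} = {\<epsilon>..s} \<union> {s<..}" using \<epsilon> by auto
    hence "(LBINT t:{\<epsilon>..}. exp (- t) / t) = (LBINT t:{\<epsilon>..s}. exp (- t) / t) + (LBINT t:{s<..}. exp (- t) / t)"
      using int tail
      by (simp only:) (subst set_integral_Un, auto)
    moreover have "(LBINT t:{s<..}. exp (- t) / t) = - Ei (- s)"
      using assms by (simp add: Ei_def LBINT_Ici_eq_Ioi)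
    moreover have "2 * (LBINT u:{\<epsilon>..s}. sinh u / u) = (LBINT t:{\<epsilon>..s}. exp t / t) - (LBINT t:{\<epsilon>..s}. exp (- t) / t)"
      unfolding set_integral_diff(2)[OF int, symmetric] set_integral_mult_right[symmetric]
      by (intro set_lebesgue_integral_cong) (auto simp: sinh_field_def diff_divide_distrib)
    ultimately show ?thesis using neg by simp
  qed
  have "((\<lambda>\<epsilon>. - 2 * (LBINT u:{\<epsilon>..s}. sinh u / u) - Ei (- s)) \<longlongrightarrow> - 2 * (LBINT u:{0<..s}. sinh u / u) - Ei (- s)) (at_right 0)"
    by (intro tendsto_intros tendsto_set_lebesgue_integral_at_right set_integrable_sinh_div assms) auto
  moreover have "\<forall>\<^sub>F \<epsilon> in at_right 0. - 2 * (LBINT u:{\<epsilon>..s}. sinh u / u) - Ei (- s) = ?g \<epsilon>"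
    using eventually_at_right_real[OF assms] by (rule eventually_mono) (use eq in auto)
  ultimately have "(?g \<longlongrightarrow> - 2 * (LBINT u:{0<..s}. sinh u / u) - Ei (- s)) (at_right 0)"
    by (rule Lim_transform_eventually)
  hence "Lim (at_right 0) ?g = - 2 * (LBINT u:{0<..s}. sinh u / u) - Ei (- s)"
    by (intro tendsto_Lim) auto
  moreover have "Ei s = - Lim (at_right 0) ?g" using assms unfolding Ei_def by simp
  ultimately show ?thesis by simp
qed

text \<open>
  As the Langevin function is odd, only the odd part \<open>-sinh\<close> of the exponential contributes, and
  \<open>sinh u * langevin u = cosh u - sinh u / u\<close>.
\<close>

lemma langevin_middle:
  assumes "s > 0"
  shows "(LBINT u:{-s<..s}. exp (- u) * langevin u) = 2 * (LBINT u:{0<..s}. sinh u / u) - 2 * sinh s"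
proof -
  let ?h = "\<lambda>u. exp (- u) * langevin u"
  have int: "integrable lborel (\<lambda>u. indicator {-s<..s} u *\<^sub>R ?h u)"
    unfolding set_integrable_def[symmetric]
    by (rule set_integrable_subset[OF set_integrable_exp_langevin[of "- s"]]) auto
  have "(LBINT u:{-s<..s}. ?h u) =
      (LBINT u:{0<..}. indicator {-s<..s} u *\<^sub>R ?h u + indicator {-s<..s} (- u) *\<^sub>R ?h (- u))"
    unfolding set_lebesgue_integral_def[of _ "{-s<..s}"] by (rule LBINT_symmetrize[OF int])
  also have "\<dots> = (LBINT u:{0<..s}. 2 * (sinh u / u) - 2 * cosh u)"
    unfolding set_lebesgue_integral_def
  proof (intro integral_cong_AE)
    show "AE u in lborel. indicator {0<..} u *\<^sub>R (indicator {-s<..s} u *\<^sub>R ?h u + indicator {-s<..s} (- u) *\<^sub>R ?h (- u))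
       = indicator {0<..s} u *\<^sub>R (2 * (sinh u / u) - 2 * cosh u)"
      using AE_lborel_singleton[of s]
    proof eventually_elim
      case (elim u)
      show ?case
      proof (cases "0 < u \<and> u < s")
        case True
        have "?h u + ?h (- u) = - (2 * sinh u) * langevin u"
          by (simp add: langevin_minus sinh_field_def field_simps)
        also have "\<dots> = 2 * (sinh u / u) - 2 * cosh u"
          using True by (simp add: langevin_def field_simps)
        finally show ?thesis using True by (simp add: indicator_def)
      qed (use elim in \<open>auto simp: indicator_def\<close>)
    qed
  qed auto
  also have "\<dots> = 2 * (LBINT u:{0<..s}. sinh u / u) - 2 * (LBINT u:{0<..s}. cosh u)"
  proof -
    have "set_integrable lborel {0..s} (cosh :: real \<Rightarrow> real)"
      by (intro borel_integrable_atLeastAtMost' continuous_on_cosh continuous_on_id)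
    hence "set_integrable lborel {0<..s} (cosh :: real \<Rightarrow> real)"
      by (rule set_integrable_subset) auto
    from set_integral_diff(2)[OF set_integrable_mult_right[OF set_integrable_sinh_div, of s 2] set_integrable_mult_right[OF this, of 2]]
    show ?thesis by (simp only: set_integral_mult_right)
  qed
  also have "(LBINT u:{0<..s}. cosh u) = (LBINT u. indicator {0..s} u *\<^sub>R cosh u)"
    unfolding set_lebesgue_integral_def
    using AE_lborel_singleton[of 0] by (intro integral_cong_AE) (auto simp: indicator_def)
  also have "\<dots> = sinh s - sinh 0"
    using assms
    by (intro integral_FTC_atLeastAtMost)
       (auto intro!: derivative_eq_intros continuous_on_cosh continuous_on_id simp flip: has_real_derivative_iff_has_vector_derivative)
  finally show ?thesis by simp
qed

lemma fourier_S_minus: "fourier_S (- s) = fourier_S s"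
  by (simp add: fourier_S_def)

text \<open>
  The bridge formula with \<open>w = 1\<close>, added up for the shifts \<open>s\<close> and \<open>-s\<close>, makes the sines cancel.
  It expresses the cosine transform by two integrals of \<open>exp (-u) * langevin u\<close>, over \<open>(s, \<infinity>)\<close> and over
  \<open>(-s, \<infinity>)\<close>; the second is split at \<open>s\<close> into the middle part and the tail computed above.
\<close>

lemma cosine_transform_eq_fourier_S:
  assumes "s \<noteq> 0"
  shows "2 * (LBINT x:{0<..}. bose x * (x * cos (s * x) / (1 + x\<^sup>2))) = fourier_S s"
proof -
  have pos: "2 * (LBINT x:{0<..}. bose x * (x * cos (s * x) / (1 + x\<^sup>2))) = fourier_S s" if s: "s > 0" for s
  proof -
    let ?h = "\<lambda>u. exp (- u) * langevin u"
    let ?b = "\<lambda>s x. bose x * ((sin (s * x) + x * cos (s * x)) / (1 + x\<^sup>2))"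
    define K where "K = (LBINT u:{s<..}. ?h u)"
    define J where "J = (LBINT u:{-s<..s}. ?h u)"
    define Shi where "Shi = (LBINT u:{0<..s}. sinh u / u)"
    have int: "set_integrable lborel {0<..} (?b s)" "set_integrable lborel {0<..} (?b (- s))"
      using Laplace_langevin_shift(2)[of 1 s] Laplace_langevin_shift(2)[of 1 "- s"] by simp_all
    have val: "exp s * (LBINT u:{s<..}. ?h u) = 2 * (LBINT x:{0<..}. ?b s x)" for s
      using Laplace_langevin_shift(3)[of 1 s] Laplace_shift(1)[of langevin s] by simp
    have "(LBINT x:{0<..}. ?b s x) + (LBINT x:{0<..}. ?b (- s) x) = 2 * (LBINT x:{0<..}. bose x * (x * cos (s * x) / (1 + x\<^sup>2)))"
      unfolding set_integral_add(2)[OF int, symmetric] set_integral_mult_right[symmetric]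
      by (intro set_lebesgue_integral_cong) (auto simp: add_divide_distrib diff_divide_distrib algebra_simps)
    hence "2 * (2 * (LBINT x:{0<..}. bose x * (x * cos (s * x) / (1 + x\<^sup>2)))) =
        exp s * (LBINT u:{s<..}. ?h u) + exp (- s) * (LBINT u:{-s<..}. ?h u)"
      unfolding val by linarith
    also have "(LBINT u:{-s<..}. ?h u) = J + K"
    proof -
      have split: "{-s<..} = {-s<..s} \<union> {s<..}" using s by auto
      have disj: "{-s<..s} \<inter> {s<..} = {}" by auto
      have int': "set_integrable lborel {-s<..s} ?h"
        by (rule set_integrable_subset[OF set_integrable_exp_langevin[of "- s"]]) auto
      show ?thesis unfolding J_def K_def split
        by (rule set_integral_Un[OF disj int' set_integrable_exp_langevin[of s]])
    qed
    finally have c: "2 * (2 * (LBINT x:{0<..}. bose x * (x * cos (s * x) / (1 + x\<^sup>2)))) = exp s * K + exp (- s) * (J + K)"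
      by (simp add: K_def)
    define E where "E = exp s"
    define L where "L = ln ((1 + exp (- s)) / (1 - exp (- s)))"
    define D where "D = exp (- s)"
    have ED: "E * D = 1" by (simp add: E_def D_def exp_add[symmetric])
    have K: "K = Ei (- s) + L - D"
      unfolding K_def L_def D_def by (rule langevin_tail[OF s])
    have J: "J = 2 * Shi - (E - D)"
    proof -
      have "2 * sinh s = E - D" by (simp add: sinh_field_def D_def E_def)
      thus ?thesis using langevin_middle[OF s] unfolding J_def Shi_def by linarith
    qed
    have "2 * fourier_S s = D * Ei s + E * Ei (- s) + 2 * cosh s * L - 2"
      using s by (simp add: fourier_S_def L_def D_def E_def algebra_simps)
    also have "2 * cosh s = E + D" by (simp add: cosh_field_def D_def E_def)
    also have "D * Ei s + E * Ei (- s) + (E + D) * L - 2 = E * K + D * (J + K)"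
      unfolding K J Ei_pos[OF s] Shi_def[symmetric] using ED by algebra
    finally show ?thesis using c unfolding D_def E_def by linarith
  qed
  show ?thesis
  proof (cases "s > 0")
    case False
    thus ?thesis using assms pos[of "- s"] by (simp add: fourier_S_minus)
  qed (rule pos)
qed

section \<open>Uniqueness of the characteristics\<close>

text \<open>
  Under \<open>u = exp (-t)\<close> the hypothesis says that \<open>h\<close> is orthogonal to all polynomials in \<open>u\<close> with respect
  to the weight \<open>exp (-N t)\<close>. The function \<open>u * h (- ln u)\<close> extends continuously to \<open>[0, 1]\<close>, so by
  Weierstrass it is a uniform limit of polynomials, hence \<open>h\<close> is orthogonal to \<open>exp (-t) * h t\<close>
  and vanishes.
\<close>

lemma Lerch_uniqueness:
  fixes h :: "real \<Rightarrow> real" and N :: nat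
  assumes cont: "continuous_on UNIV h" and bound: "\<And>t. \<bar>h t\<bar> \<le> B"
    and "N > 0" and zero: "\<And>n. n \<ge> N \<Longrightarrow> (LBINT t:{0<..}. exp (- (real n * t)) * h t) = 0"
    and "t > 0"
  shows "h t = 0"
proof -
  define q where "q = (\<lambda>u. if u > 0 then u * h (- ln u) else 0)"
  have B: "B \<ge> 0" using bound[of 1] by linarith
  have [measurable]: "h \<in> borel_measurable borel"
    using cont by (rule borel_measurable_continuous_onI)
  have weight_int: "set_integrable lborel {0<..} (\<lambda>t. exp (- (real n * t)) * g t)"
    if "n > 0" "\<And>t. t > 0 \<Longrightarrow> \<bar>g t\<bar> \<le> C" and [measurable]: "g \<in> borel_measurable borel" for n g C
  proof -
    have "set_integrable lborel {0<..} (\<lambda>t. exp (- (real n * t)) * C)"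
      using that by (intro set_integrable_mult_left set_integrable_exp_halfline_real) auto
    thus ?thesis
    proof (rule set_integrable_bound)
      show "AE t in lborel. t \<in> {0<..} \<longrightarrow> norm (exp (- (real n * t)) * g t) \<le> norm (exp (- (real n * t)) * C)"
        by (intro AE_I2) (use that(2) in \<open>force simp: abs_mult\<close>)
    qed (auto simp: set_borel_measurable_def)
  qed
  have q_cont: "continuous_on {0..1} q"
    unfolding continuous_on_eq_continuous_within
  proof
    fix u :: real assume u: "u \<in> {0..1}"
    have "continuous (at u) q"
    proof (cases "u = 0")
      case False
      have "continuous_on {0<..} (\<lambda>u. u * h (- ln u))"
        by (intro continuous_intros continuous_on_compose2[OF cont]) auto
      hence "isCont (\<lambda>u. u * h (- ln u)) u"
        using False u by (auto simp: continuous_on_eq_continuous_at)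
      moreover have "\<forall>\<^sub>F v in nhds u. v * h (- ln v) = q v"
        using eventually_nhds_in_open[of "{0<..}" u] u False by (auto elim!: eventually_mono simp: q_def)
      ultimately show ?thesis by (subst (asm) isCont_cong)
    next
      case True
      have "((\<lambda>u::real. \<bar>u\<bar> * B) \<longlongrightarrow> 0 * B) (at 0)"
        by (intro tendsto_mult_right tendsto_rabs_zero tendsto_ident_at)
      moreover have "norm (q u) \<le> \<bar>u\<bar> * B" for u
        using bound[of "- ln u"] B by (auto simp: q_def abs_mult intro!: mult_left_mono mult_nonpos_nonneg)
      ultimately have "(q \<longlongrightarrow> 0) (at 0)"
        by (intro Lim_null_comparison[of q "\<lambda>u. \<bar>u\<bar> * B"]) auto
      thus ?thesis using True by (simp add: isCont_def q_def)
    qed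
    thus "continuous (at u within {0..1}) q" by (rule continuous_at_imp_continuous_at_within)
  qed
  \<comment> \<open>As \<open>exp (-t) * h t = q (exp (-t))\<close>, this is an integral of \<open>h\<close> against a limit of polynomials.\<close>
  define I where "I = (LBINT t:{0<..}. exp (- (real N * t)) * (exp (- t) * (h t * h t)))"
  have h2_int: "set_integrable lborel {0<..} (\<lambda>t. exp (- (real N * t)) * (exp (- t) * (h t * h t)))"
  proof (rule weight_int[OF \<open>N > 0\<close>])
    show "\<bar>exp (- t) * (h t * h t)\<bar> \<le> 1 * (B * B)" if "t > 0" for t
      unfolding abs_mult by (intro mult_mono) (use bound B that in auto)
  qed auto
  have "\<bar>I\<bar> \<le> e" if "e > 0" for e
  proof -
    define d where "d = e / (B + 1)"
    have d: "d > 0" using that B by (simp add: d_def)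
    obtain p where p: "real_polynomial_function p" "\<And>u. u \<in> {0..1} \<Longrightarrow> \<bar>q u - p u\<bar> < d"
      using Stone_Weierstrass_real_polynomial_function[OF compact_Icc q_cont d] by blast
    then obtain a m where pa: "p = (\<lambda>x. \<Sum>i\<le>m. a i * x ^ i)"
      by (auto simp: real_polynomial_function_iff_sum)
    have mono: "exp (- (real N * t)) * (h t * exp (- t) ^ i) = exp (- (real (N + i) * t)) * h t" for t i
      by (simp add: exp_of_nat_mult[symmetric] exp_add[symmetric] algebra_simps)
    have p_int: "set_integrable lborel {0<..} (\<lambda>t. exp (- (real (N + i) * t)) * h t)" for i
      using \<open>N > 0\<close> bound by (intro weight_int[of _ _ B]) auto
    \<comment> \<open>A polynomial in \<open>exp (-t)\<close> only involves exponents at which the Laplace transform of \<open>h\<close> vanishes.\<close>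
    have "exp (- (real N * t)) * (h t * p (exp (- t))) = (\<Sum>i\<le>m. a i * (exp (- (real (N + i) * t)) * h t))" for t
      unfolding pa mono[symmetric] by (simp add: sum_distrib_left mult_ac)
    hence eq: "(\<lambda>t. exp (- (real N * t)) * (h t * p (exp (- t)))) = (\<lambda>t. \<Sum>i\<le>m. a i * (exp (- (real (N + i) * t)) * h t))"
      by blast
    have hp: "set_integrable lborel {0<..} (\<lambda>t. exp (- (real N * t)) * (h t * p (exp (- t))))"
      unfolding eq set_integrable_def scaleR_sum_right
      by (intro Bochner_Integration.integrable_sum)
         (use set_integrable_mult_right[OF p_int] in \<open>simp add: set_integrable_def\<close>)
    have "(LBINT t:{0<..}. exp (- (real N * t)) * (h t * p (exp (- t)))) =
        (\<Sum>i\<le>m. (LBINT t:{0<..}. a i * (exp (- (real (N + i) * t)) * h t)))"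
      unfolding eq set_lebesgue_integral_def scaleR_sum_right
      by (intro Bochner_Integration.integral_sum)
         (use set_integrable_mult_right[OF p_int] in \<open>simp add: set_integrable_def\<close>)
    also have "\<dots> = 0"
      by (intro sum.neutral ballI) (simp only: set_integral_mult_right zero[OF le_add1] mult_zero_right)
    finally have zero': "(LBINT t:{0<..}. exp (- (real N * t)) * (h t * p (exp (- t)))) = 0" .
    have "I = (LBINT t:{0<..}. exp (- (real N * t)) * (exp (- t) * (h t * h t)) - exp (- (real N * t)) * (h t * p (exp (- t))))"
      unfolding I_def set_integral_diff(2)[OF h2_int hp] zero' by simp
    also have "\<bar>\<dots>\<bar> \<le> (LBINT t:{0<..}. exp (- (real N * t)) * (B * d))"
      unfolding set_lebesgue_integral_def
    proof (rule integral_abs_bound[THEN order_trans], rule integral_mono)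
      show "integrable lborel (\<lambda>t. \<bar>indicator {0<..} t *\<^sub>R (exp (- (real N * t)) * (exp (- t) * (h t * h t)) - exp (- (real N * t)) * (h t * p (exp (- t))))\<bar>)"
        using set_integral_diff(1)[OF h2_int hp] by (intro integrable_abs) (simp add: set_integrable_def)
      show "integrable lborel (\<lambda>t. indicator {0<..} t *\<^sub>R (exp (- (real N * t)) * (B * d)))"
        using set_integrable_mult_left[OF set_integrable_exp_halfline_real[of "real N"], of "B * d"] \<open>N > 0\<close>
        by (simp add: set_integrable_def)
      fix t :: real
      show "\<bar>indicator {0<..} t *\<^sub>R (exp (- (real N * t)) * (exp (- t) * (h t * h t)) - exp (- (real N * t)) * (h t * p (exp (- t))))\<bar>
        \<le> indicator {0<..} t *\<^sub>R (exp (- (real N * t)) * (B * d))"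
      proof (cases "t > 0")
        case True
        have "exp (- (real N * t)) * (exp (- t) * (h t * h t)) - exp (- (real N * t)) * (h t * p (exp (- t)))
          = exp (- (real N * t)) * (h t * (q (exp (- t)) - p (exp (- t))))"
          by (simp add: q_def algebra_simps)
        moreover have "\<bar>h t * (q (exp (- t)) - p (exp (- t)))\<bar> \<le> B * d"
          unfolding abs_mult using p(2)[of "exp (- t)"] True bound[of t] B
          by (intro mult_mono) auto
        ultimately show ?thesis using True by (simp add: abs_mult[of "exp _"])
      qed auto
    qed
    also have "\<dots> = B * d / real N"
      using LBINT_exp_halfline_real[of "real N"] \<open>N > 0\<close> by simp
    also have "\<dots> \<le> B * d / 1"
      using \<open>N > 0\<close> B d by (intro divide_left_mono) auto
    also have "\<dots> \<le> e" using that B by (simp add: d_def field_simps)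
    finally show ?thesis .
  qed
  hence "I = 0"
    by (metis abs_ge_zero abs_le_zero_iff dense_le_bounded field_le_epsilon add_0)
  hence "AE t in lborel. indicator {0<..} t *\<^sub>R (exp (- (real N * t)) * (exp (- t) * (h t * h t))) = 0"
    using h2_int unfolding I_def set_lebesgue_integral_def set_integrable_def
    by (subst (asm) integral_nonneg_eq_0_iff_AE) (auto simp: indicator_def)
  hence "AE t in lborel. \<not> (t > 0 \<and> h t \<noteq> 0)"
    by (rule eventually_mono) (auto simp: indicator_def split: if_splits)
  hence "{t. t > 0 \<and> h t \<noteq> 0} \<in> null_sets lborel"
    by (subst (asm) AE_iff_null) auto
  hence "negligible {t. t > 0 \<and> h t \<noteq> 0}"
    by (simp add: negligible_iff_null_sets null_sets_completionI)
  moreover have "open {t. t > 0 \<and> h t \<noteq> 0}"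
    by (intro open_Collect_conj open_Collect_less open_Collect_neq continuous_intros cont)
  ultimately show ?thesis using open_not_negligible \<open>t > 0\<close> by blast
qed

lemma (in finite_borel_measure) char_properties:
  shows isCont_char: "isCont (char M) t"
    and norm_char_le: "norm (char M t) \<le> measure M UNIV"
    and char_uminus: "char M (- t) = cnj (char M t)"
    and char_0: "char M 0 = of_real (measure M UNIV)"
proof -
  note [measurable_cong] = M_is_borel
  note [simp] = borel_UNIV
  show "isCont (char M) t"
    unfolding continuous_at_sequentially
  proof safe
    fix X assume X: "X \<longlonglongrightarrow> t"
    show "(char M \<circ> X) \<longlonglongrightarrow> char M t"
      unfolding comp_def char_def
      by (rule integral_dominated_convergence[where w = "\<lambda>_. 1"]) (auto intro!: tendsto_intros X)
  qed
  have "norm (char M t) \<le> (\<integral>x. norm (iexp (t * x)) \<partial>M)"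
    unfolding char_def by (rule integral_norm_bound)
  thus "norm (char M t) \<le> measure M UNIV" by (simp del: of_real_mult)
  show "char M (- t) = cnj (char M t)"
  proof -
    have "cnj (char M t) = (\<integral>x. cnj (iexp (t * x)) \<partial>M)"
      unfolding char_def by (simp only: Bochner_Integration.integral_cnj)
    thus ?thesis by (simp add: char_def exp_cnj)
  qed
  show "char M 0 = of_real (measure M UNIV)" by (simp add: char_def scaleR_conv_of_real)
qed

text \<open>
  Levy's uniqueness theorem for probability measures applies after normalisation by the common total
  mass, the value of both characteristic functions at \<open>0\<close>.
\<close>

lemma finite_measure_char_unique:
  assumes "finite_borel_measure M1" "finite_borel_measure M2" and eq: "char M1 = char M2"
  shows "M1 = M2"
proof -
  interpret M1: finite_borel_measure M1 by fact
  interpret M2: finite_borel_measure M2 by fact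
  note [measurable_cong] = M1.M_is_borel M2.M_is_borel
  define m where "m = measure M1 UNIV"
  have m: "measure M2 UNIV = m"
    using M1.char_0 M2.char_0 eq by (simp add: m_def)
  have sets: "sets M1 = sets M2" using M1.M_is_borel M2.M_is_borel by simp
  show ?thesis
  proof (cases "m = 0")
    case True
    have "measure M1 A = 0 \<and> measure M2 A = 0" for A
      using M1.bounded_measure[of A] M2.bounded_measure[of A] True m
      by (simp add: M1.borel_UNIV M2.borel_UNIV m_def measure_le_0_iff)
    thus ?thesis using sets
      by (intro measure_eqI) (auto simp: M1.emeasure_eq_measure M2.emeasure_eq_measure)
  next
    case False
    hence mpos: "m > 0" by (simp add: m_def zero_less_measure_iff)
    let ?N = "\<lambda>M. density M (\<lambda>_. ennreal (1 / m))"
    have em: "emeasure (?N M) A = ennreal (1 / m) * emeasure M A" if "A \<in> sets M" for M and A :: "real set"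
      using that by (simp add: emeasure_density nn_integral_cmult)
    have dist: "real_distribution (?N M)" if "finite_borel_measure M" "measure M UNIV = m" for M
    proof -
      interpret finite_borel_measure M by fact
      have "emeasure (?N M) UNIV = 1"
        using em[of UNIV M] that(2) mpos
        by (simp add: emeasure_eq_measure M_is_borel ennreal_mult[symmetric])
      thus ?thesis
        by (intro real_distribution.intro prob_spaceI real_distribution_axioms.intro)
           (simp_all add: borel_UNIV M_is_borel)
    qed
    have char: "char (?N M) t = (1 / m) *\<^sub>R char M t" if "finite_borel_measure M" for M t
    proof -
      interpret finite_borel_measure M by fact
      note [measurable_cong] = M_is_borel
      show ?thesis unfolding char_def using mpos by (subst integral_density) auto
    qed
    have "char (?N M1) = char (?N M2)"
      by (rule ext) (simp only: char[OF assms(1)] char[OF assms(2)] eq)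
    hence "?N M1 = ?N M2"
      by (rule Levy_uniqueness[OF dist[OF assms(1) m_def[symmetric]] dist[OF assms(2) m]])
    hence *: "ennreal (1 / m) * emeasure M1 A = ennreal (1 / m) * emeasure M2 A" if "A \<in> sets M1" for A
      using that em[of A M1] em[of A M2] sets by simp
    have "emeasure M1 A = emeasure M2 A" if "A \<in> sets M1" for A
      using *[OF that] mpos by (subst (asm) ennreal_mult_cancel_left) auto
    thus ?thesis using sets by (intro measure_eqI) auto
  qed
qed

lemma (in finite_borel_measure) Laplace_char:
  assumes "w > 0"
  shows "(LBINT t:{0<..}. exp (- (of_real w * of_real t)) * char M t) = (\<integral>x. 1 / (of_real w - \<i> * of_real x) \<partial>M)"
    and "set_integrable lborel {0<..} (\<lambda>t. exp (- (of_real w * of_real t)) * char M t)"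
proof -
  note [measurable_cong] = M_is_borel
  define f where "f = (\<lambda>x t::real. indicator {0<..} t *\<^sub>R (exp (- (of_real w * of_real t)) * iexp (t * x)))"
  define h2 where "h2 = (\<lambda>t::real. indicator {0<..} t * exp (- (w * t)))"
  have meas: "case_prod f \<in> borel_measurable (M \<Otimes>\<^sub>M lborel)" unfolding f_def by measurable
  have h: "integrable M (\<lambda>_. 1::real)" "integrable lborel h2"
    using set_integrable_exp_halfline_real[OF assms] by (auto simp: set_integrable_def h2_def)
  have bound: "norm (f x t) \<le> 1 * h2 t" for x t
    by (auto simp: f_def h2_def indicator_def norm_mult)
  note Fub = Fubini_dominated[OF sigma_finite_measure_axioms lborel.sigma_finite_measure_axioms meas h bound]
  have inner_x: "(\<integral>x. f x t \<partial>M) = indicator {0<..} t *\<^sub>R (exp (- (of_real w * of_real t)) * char M t)" for t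
    by (simp add: f_def char_def)
  have inner_t: "(LBINT t. f x t) = 1 / (of_real w - \<i> * of_real x)" for x
  proof -
    have "(LBINT t. f x t) = (LBINT t:{0<..}. exp (- ((of_real w - \<i> * of_real x) * of_real t)))"
      unfolding f_def set_lebesgue_integral_def exp_add[symmetric]
      by (simp add: algebra_simps)
    also have "\<dots> = 1 / (of_real w - \<i> * of_real x)"
      using assms by (intro LBINT_exp_halfline) simp
    finally show ?thesis .
  qed
  show "(LBINT t:{0<..}. exp (- (of_real w * of_real t)) * char M t) = (\<integral>x. 1 / (of_real w - \<i> * of_real x) \<partial>M)"
    using Fub(1) unfolding inner_x inner_t set_lebesgue_integral_def .
  show "set_integrable lborel {0<..} (\<lambda>t. exp (- (of_real w * of_real t)) * char M t)"
    using Fub(2) unfolding inner_x set_integrable_def .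
qed

text \<open>
  On the imaginary axis the Nevanlinna kernel is an affine function of \<open>1 / (w - \<i>x)\<close>, and the
  integral of the latter is the Laplace transform of the characteristic function.
\<close>

lemma (in finite_borel_measure) Nevanlinna_integral_Laplace_char:
  assumes "w > 0"
  shows "(\<integral>x. (\<i> * of_real w * of_real x - 1) / (\<i> * of_real w + of_real x) \<partial>M) =
     \<i> * of_real (w * measure M UNIV) + \<i> * of_real (1 - w\<^sup>2) *
       (LBINT t:{0<..}. exp (- (of_real w * of_real t)) * char M t)"
proof -
  note [measurable_cong] = M_is_borel
  have nz: "of_real w - \<i> * of_real x \<noteq> 0" for x using assms by (auto simp: complex_eq_iff)
  have eq: "(\<i> * of_real w * of_real x - 1) / (\<i> * of_real w + of_real x) =
      \<i> * of_real w + \<i> * of_real (1 - w\<^sup>2) * (1 / (of_real w - \<i> * of_real x))" for x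
  proof -
    define W z where "W = complex_of_real w" and "z = complex_of_real w - \<i> * of_real x"
    have z: "z \<noteq> 0" using nz[of x] by (simp add: z_def)
    have num: "\<i> * of_real w * of_real x - 1 = W * (W - z) - 1" and den: "\<i> * of_real w + of_real x = \<i> * z"
      by (simp_all add: z_def W_def algebra_simps)
    have quot: "(W * (W - z) - 1) / (\<i> * z) = \<i> * W + \<i> * (1 - W\<^sup>2) * (1 / z)"
    proof -
      have "(\<i> * W + \<i> * (1 - W\<^sup>2) * (1 / z)) * (\<i> * z) = \<i> * \<i> * (W * z + (1 - W\<^sup>2) * (z / z))"
        by (simp add: algebra_simps)
      also have "\<dots> = W * (W - z) - 1" using z by (simp add: algebra_simps power2_eq_square)
      finally show ?thesis using z by (subst divide_eq_eq) auto
    qed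
    show ?thesis unfolding num den quot by (simp add: W_def z_def)
  qed
  have "norm (1 / (of_real w - \<i> * of_real x)) \<le> 1 / w" for x
  proof -
    have "w \<le> norm (of_real w - \<i> * of_real x)"
      using complex_Re_le_cmod[of "of_real w - \<i> * of_real x"] by simp
    thus ?thesis using assms by (simp add: norm_divide field_simps)
  qed
  hence int: "integrable M (\<lambda>x. 1 / (of_real w - \<i> * of_real x))"
    by (intro integrable_const_bound[where B = "1 / w"]) auto
  have affine: "(\<integral>x. A + c * f x \<partial>M) = of_real (measure M UNIV) * A + c * (\<integral>x. f x \<partial>M)"
    if "integrable M f" for A c :: complex and f
    using that by (subst Bochner_Integration.integral_add) (auto simp: borel_UNIV scaleR_conv_of_real)
  show ?thesis unfolding eq Laplace_char(1)[OF assms] affine[OF int] by simp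
qed

text \<open>
  At \<open>w = 1\<close> the Laplace transform drops out, so the real part of \<open>F \<i>\<close> is \<open>a\<close> and its imaginary
  part is \<open>b\<close> plus the total mass. For \<open>w > 1\<close> the values of \<open>F\<close> then determine the Laplace transform of
  the characteristic function, which determines the measure, its mass, and finally \<open>b\<close>.
\<close>

lemma has_characteristics_unique:
  assumes "has_characteristics F a b M" "has_characteristics F a' b' M'"
  shows "a = a' \<and> b = b' \<and> M = M'"
proof -
  interpret M: finite_borel_measure M using assms by (simp add: has_characteristics_def)
  interpret M': finite_borel_measure M' using assms by (simp add: has_characteristics_def)
  define m m' where "m = measure M UNIV" and "m' = measure M' UNIV"
  define L L' where "L = (\<lambda>w. LBINT t:{0<..}. exp (- (of_real w * of_real t)) * char M t)"
    and "L' = (\<lambda>w. LBINT t:{0<..}. exp (- (of_real w * of_real t)) * char M' t)"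
  have F0: "F (\<i> * of_real w) = of_real a + \<i> * of_real b * of_real w + (\<i> * of_real (w * m) + \<i> * of_real (1 - w\<^sup>2) * L w)"
     if "w > 0" for w
    using assms(1) that unfolding has_characteristics_def L_def m_def
    by (simp only: M.Nevanlinna_integral_Laplace_char[OF that, symmetric])
  have F0': "F (\<i> * of_real w) = of_real a' + \<i> * of_real b' * of_real w + (\<i> * of_real (w * m') + \<i> * of_real (1 - w\<^sup>2) * L' w)"
     if "w > 0" for w
    using assms(2) that unfolding has_characteristics_def L'_def m'_def
    by (simp only: M'.Nevanlinna_integral_Laplace_char[OF that, symmetric])
  have F: "F (\<i> * of_real w) = of_real a + \<i> * of_real (w * (b + m)) + \<i> * of_real (1 - w\<^sup>2) * L w"
       "F (\<i> * of_real w) = of_real a' + \<i> * of_real (w * (b' + m')) + \<i> * of_real (1 - w\<^sup>2) * L' w"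
    if "w > 0" for w
    by (simp add: F0[OF that] algebra_simps) (simp add: F0'[OF that] algebra_simps)
  have "complex_of_real a + \<i> * of_real (b + m) = of_real a' + \<i> * of_real (b' + m')"
    using F(1)[of 1] F(2)[of 1] by simp
  hence a: "a = a'" and bm: "b + m = b' + m'" by (auto simp: complex_eq_iff)
  have LL: "L w = L' w" if "w > 1" for w
  proof -
    have "w\<^sup>2 \<noteq> 1" using that by (simp add: power2_eq_1_iff)
    hence "(of_real (1 - w\<^sup>2) :: complex) \<noteq> 0" by (simp only: of_real_eq_0_iff)
    moreover have "of_real (1 - w\<^sup>2) * L w = of_real (1 - w\<^sup>2) * L' w"
      using F(1)[of w] F(2)[of w] that unfolding a bm by auto
    ultimately show ?thesis by simp
  qed
  define h where "h = (\<lambda>t. char M t - char M' t)"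
  have h_int: "set_integrable lborel {0<..} (\<lambda>t. exp (- (of_real w * of_real t)) * h t)"
    and h_zero: "(LBINT t:{0<..}. exp (- (of_real w * of_real t)) * h t) = 0" if "w > 1" for w
    using set_integral_diff[OF M.Laplace_char(2) M'.Laplace_char(2), of w w] LL[OF that] that
    unfolding h_def right_diff_distrib L_def L'_def by auto
  have h_cont: "continuous_on UNIV h"
    unfolding h_def by (intro continuous_on_diff continuous_at_imp_continuous_on ballI M.isCont_char M'.isCont_char)
  have h_bound: "norm (h t) \<le> m + m'" for t
    unfolding h_def m_def m'_def
    using norm_triangle_ineq4[of "char M t" "char M' t"] M.norm_char_le[of t] M'.norm_char_le[of t] by linarith
  have exp_real: "exp (- (complex_of_real w * of_real t)) * z = exp (- (w * t)) *\<^sub>R z" for w t z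
    by (simp add: scaleR_conv_of_real exp_of_real[symmetric])
  have "h t = 0" if "t > 0" for t
  proof -
    \<comment> \<open>Exponents from \<open>2\<close> on avoid \<open>w = 1\<close>, where \<open>F\<close> carries no information on the transform.\<close>
    have Re: "Re (h t) = 0"
    proof (rule Lerch_uniqueness[where h = "\<lambda>t. Re (h t)" and N = 2])
      show "\<bar>Re (h t)\<bar> \<le> m + m'" for t using abs_Re_le_cmod[of "h t"] h_bound[of t] by linarith
      show "(LBINT t:{0<..}. exp (- (real n * t)) * Re (h t)) = 0" if "n \<ge> 2" for n
      proof -
        have n: "real n > 1" using that by simp
        have "(LBINT t:{0<..}. exp (- (real n * t)) * Re (h t)) = Re (LBINT t:{0<..}. exp (- (of_real (real n) * of_real t)) * h t)"
          using h_int[OF n] unfolding set_lebesgue_integral_def set_integrable_def exp_real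
          by (subst integral_Re[symmetric]) (auto simp: mult.assoc)
        thus ?thesis unfolding h_zero[OF n] by simp
      qed
    qed (use that in \<open>auto intro!: continuous_intros h_cont\<close>)
    have Im: "Im (h t) = 0"
    proof (rule Lerch_uniqueness[where h = "\<lambda>t. Im (h t)" and N = 2])
      show "\<bar>Im (h t)\<bar> \<le> m + m'" for t using abs_Im_le_cmod[of "h t"] h_bound[of t] by linarith
      show "(LBINT t:{0<..}. exp (- (real n * t)) * Im (h t)) = 0" if "n \<ge> 2" for n
      proof -
        have n: "real n > 1" using that by simp
        have "(LBINT t:{0<..}. exp (- (real n * t)) * Im (h t)) = Im (LBINT t:{0<..}. exp (- (of_real (real n) * of_real t)) * h t)"
          using h_int[OF n] unfolding set_lebesgue_integral_def set_integrable_def exp_real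
          by (subst integral_Im[symmetric]) (auto simp: mult.assoc)
        thus ?thesis unfolding h_zero[OF n] by simp
      qed
    qed (use that in \<open>auto intro!: continuous_intros h_cont\<close>)
    show ?thesis using Re Im by (simp add: complex_eq_iff)
  qed
  note pos = this
  have neg: "h t = 0" if "t < 0" for t
    using pos[of "- t"] that M.char_uminus[of "- t"] M'.char_uminus[of "- t"] by (simp add: h_def)
  have "h 0 = 0"
  proof (rule tendsto_unique[where F = "at (0::real)"])
    show "(h \<longlongrightarrow> h 0) (at 0)" using h_cont by (simp add: continuous_on_eq_continuous_at isCont_def)
    have "h t = 0" if "t \<noteq> 0" for t using that pos[of t] neg[of t] by linarith
    thus "(h \<longlongrightarrow> 0) (at 0)"
      by (intro tendsto_eventually) (auto simp: eventually_at_filter)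
  qed auto
  hence "h t = 0" for t using pos[of t] neg[of t] by (cases t "0::real" rule: linorder_cases) auto
  hence "char M = char M'" by (auto simp: h_def fun_eq_iff)
  hence "M = M'" by (intro finite_measure_char_unique M.finite_borel_measure_axioms M'.finite_borel_measure_axioms)
  moreover have "b = b'" using bm \<open>M = M'\<close> by (simp add: m_def m'_def)
  ultimately show ?thesis using a by simp
qed

section \<open>The measure and its characteristics\<close>

definition rho_density :: "real \<Rightarrow> real" where
  "rho_density x = \<bar>x\<bar> / ((1 + x\<^sup>2) * (exp (pi * \<bar>x\<bar>) - 1))"

definition rho :: "real measure" where
  "rho = density lborel (\<lambda>x. ennreal (rho_density x))"

lemma measurable_rho_density [measurable]: "rho_density \<in> borel_measurable borel"
  unfolding rho_density_def by measurable

lemma rho_density_nonneg: "0 \<le> rho_density x"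
  by (simp add: rho_density_def)

lemma rho_density_minus: "rho_density (- x) = rho_density x"
  by (simp add: rho_density_def)

lemma rho_density_pos: "x > 0 \<Longrightarrow> rho_density x = bose x * (x / (1 + x\<^sup>2))"
  by (simp add: rho_density_def bose_def)

lemma integrable_rho_density: "integrable lborel rho_density"
proof -
  have "set_integrable lborel {0<..} rho_density"
  proof (rule set_integrable_bound[OF set_integrable_id_bose])
    have "rho_density x \<le> x * bose x" if "x > 0" for x
    proof -
      have "x / (1 + x\<^sup>2) \<le> x / 1" using that by (intro divide_left_mono) (auto simp: add_pos_nonneg)
      hence "bose x * (x / (1 + x\<^sup>2)) \<le> bose x * x"
        using bose_pos[OF that] by (intro mult_left_mono) auto
      thus ?thesis by (simp add: rho_density_pos[OF that] mult.commute)
    qed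
    thus "AE x in lborel. x \<in> {0<..} \<longrightarrow> norm (rho_density x) \<le> norm (x * bose x)"
      using rho_density_nonneg by (intro AE_I2) (force intro: order_trans)
  qed (auto simp: set_borel_measurable_def)
  hence int: "integrable lborel (\<lambda>x. indicator {0<..} x *\<^sub>R rho_density x)"
    by (simp add: set_integrable_def)
  have "integrable lborel (\<lambda>x. indicator {0<..} x *\<^sub>R rho_density x + indicator {0<..} (0 + (- 1) * x) *\<^sub>R rho_density (0 + (- 1) * x))"
    by (intro Bochner_Integration.integrable_add int lborel_integrable_real_affine[OF int]) auto
  also have "(\<lambda>x. indicator {0<..} x *\<^sub>R rho_density x + indicator {0<..} (0 + (- 1) * x) *\<^sub>R rho_density (0 + (- 1) * x)) = rho_density"
    by (auto simp: fun_eq_iff indicator_def rho_density_minus rho_density_def)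
  finally show ?thesis .
qed

lemma finite_borel_measure_rho: "finite_borel_measure rho"
proof (intro finite_borel_measure.intro finite_borel_measure_axioms.intro finite_measureI)
  have "emeasure rho (space rho) = (\<integral>\<^sup>+x. ennreal (rho_density x) \<partial>lborel)"
    by (simp add: rho_def emeasure_density)
  also have "\<dots> = ennreal (LBINT x. rho_density x)"
    by (intro nn_integral_eq_integral integrable_rho_density AE_I2 rho_density_nonneg)
  finally show "emeasure rho (space rho) \<noteq> \<infinity>" by simp
  show "sets rho = sets borel" by (simp add: rho_def)
qed

lemma integral_rho:
  fixes g :: "real \<Rightarrow> 'a::{banach, second_countable_topology}"
  assumes [measurable]: "g \<in> borel_measurable borel" and bound: "\<And>x. norm (g x) \<le> C"
  shows "(\<integral>x. g x \<partial>rho) = (LBINT x:{0<..}. rho_density x *\<^sub>R (g x + g (- x)))"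
proof -
  have "integrable lborel (\<lambda>x. rho_density x *\<^sub>R g x)"
  proof (rule Bochner_Integration.integrable_bound)
    show "integrable lborel (\<lambda>x. C * rho_density x)"
      by (intro integrable_mult_right integrable_rho_density)
    have "\<bar>rho_density x\<bar> * norm (g x) \<le> \<bar>C * rho_density x\<bar>" for x
      using mult_right_mono[OF bound[of x] rho_density_nonneg[of x]] rho_density_nonneg[of x]
      by (simp add: mult.commute)
    thus "AE x in lborel. norm (rho_density x *\<^sub>R g x) \<le> norm (C * rho_density x)"
      by simp
  qed auto
  note sym = LBINT_symmetrize[OF this]
  have "(\<integral>x. g x \<partial>rho) = (LBINT x. rho_density x *\<^sub>R g x)"
    unfolding rho_def by (rule integral_density) (auto simp: rho_density_nonneg)
  also have "\<dots> = (LBINT x:{0<..}. rho_density x *\<^sub>R (g x + g (- x)))"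
    unfolding sym by (simp add: rho_density_minus scaleR_add_right)
  finally show ?thesis .
qed

lemma char_rho: "char rho s = of_real (2 * (LBINT x:{0<..}. rho_density x * cos (s * x)))"
proof -
  have "char rho s = (LBINT x:{0<..}. rho_density x *\<^sub>R (iexp (s * x) + iexp (s * (- x))))"
    unfolding char_def by (rule integral_rho[where C = 1]) auto
  also have "\<dots> = (LBINT x:{0<..}. complex_of_real (2 * (rho_density x * cos (s * x))))"
  proof -
    have "iexp (s * x) + iexp (s * (- x)) = of_real (2 * cos (s * x))" for x
      unfolding cis_conv_exp[symmetric] by (simp add: complex_eq_iff)
    thus ?thesis by (simp only: scaleR_conv_of_real of_real_mult[symmetric]) (simp only: mult_ac)
  qed
  also have "\<dots> = of_real (2 * (LBINT x:{0<..}. rho_density x * cos (s * x)))"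
    by (simp only: set_integral_complex_of_real set_integral_mult_right)
  finally show ?thesis .
qed

text \<open>
  The factor \<open>1 + x\<^sup>2\<close> cancels the one in the denominator of \<open>rho_density\<close>.
\<close>

lemma Nevanlinna_kernel_symmetrized:
  fixes w x :: real
  assumes "w > 0"
  shows "(\<i> * of_real w * of_real x - 1) / (\<i> * of_real w + of_real x) +
         (\<i> * of_real w * of_real (- x) - 1) / (\<i> * of_real w + of_real (- x)) =
         \<i> * of_real (2 * w * ((1 + x\<^sup>2) / (w\<^sup>2 + x\<^sup>2)))"
proof -
  define W X where "W = complex_of_real w" and "X = complex_of_real x"
  have nz: "\<i> * W + X \<noteq> 0" "\<i> * W - X \<noteq> 0" using assms by (auto simp: W_def X_def complex_eq_iff)
  have "w\<^sup>2 + x\<^sup>2 \<noteq> 0" using assms by (simp add: sum_power2_eq_zero_iff)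
  hence nz': "W\<^sup>2 + X\<^sup>2 \<noteq> 0" unfolding W_def X_def by (metis of_real_add of_real_eq_0_iff of_real_power)
  have "(\<i> * W * X - 1) / (\<i> * W + X) + (- (\<i> * W * X) - 1) / (\<i> * W - X) =
      ((\<i> * W * X - 1) * (\<i> * W - X) + (- (\<i> * W * X) - 1) * (\<i> * W + X)) / ((\<i> * W + X) * (\<i> * W - X))"
    by (rule add_frac_eq[OF nz])
  also have "(\<i> * W * X - 1) * (\<i> * W - X) + (- (\<i> * W * X) - 1) * (\<i> * W + X) = - (\<i> * (2 * W * (1 + X\<^sup>2)))"
    by (simp add: algebra_simps power2_eq_square)
  also have "(\<i> * W + X) * (\<i> * W - X) = - (W\<^sup>2 + X\<^sup>2)"
    by (simp add: algebra_simps power2_eq_square)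
  also have "- (\<i> * (2 * W * (1 + X\<^sup>2))) / - (W\<^sup>2 + X\<^sup>2) = \<i> * (2 * W * ((1 + X\<^sup>2) / (W\<^sup>2 + X\<^sup>2)))"
    by (simp only: minus_divide_divide) simp
  finally show ?thesis by (simp add: W_def X_def)
qed

lemma Nevanlinna_integral_rho:
  assumes "w > 0"
  shows "(\<integral>x. (\<i> * of_real w * of_real x - 1) / (\<i> * of_real w + of_real x) \<partial>rho) =
     \<i> * of_real (w * ln (w / 2) - w * Digamma (w / 2) - 1)"
proof -
  let ?g = "\<lambda>x. (\<i> * of_real w * of_real x - 1) / (\<i> * of_real w + complex_of_real x)"
  have bound: "norm (?g x) \<le> w + 1 / w" for x
  proof -
    let ?z = "\<i> * of_real w + complex_of_real x"
    have z: "\<bar>x\<bar> \<le> norm ?z" "w \<le> norm ?z"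
      using abs_Re_le_cmod[of ?z] abs_Im_le_cmod[of ?z] by simp_all
    have "norm (\<i> * of_real w * of_real x - 1) \<le> w * \<bar>x\<bar> + 1"
      using norm_triangle_ineq4[of "\<i> * of_real w * complex_of_real x" 1] assms by (simp add: norm_mult)
    also have "w * \<bar>x\<bar> \<le> w * norm ?z" using z assms by (intro mult_left_mono) auto
    also have "1 \<le> 1 / w * norm ?z" using z assms by (simp add: field_simps)
    finally have "norm (\<i> * of_real w * of_real x - 1) \<le> (w + 1 / w) * norm ?z"
      by (simp add: distrib_right)
    moreover have "norm ?z > 0" using z(2) assms by linarith
    ultimately show ?thesis by (simp add: norm_divide pos_divide_le_eq)
  qed
  have "(\<integral>x. ?g x \<partial>rho) = (LBINT x:{0<..}. rho_density x *\<^sub>R (?g x + ?g (- x)))"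
    by (rule integral_rho[OF _ bound]) measurable
  also have "\<dots> = (LBINT x:{0<..}. \<i> * complex_of_real (2 * w * (bose x * (x / (w\<^sup>2 + x\<^sup>2)))))"
  proof (intro set_lebesgue_integral_cong ballI)
    have "rho_density x *\<^sub>R (?g x + ?g (- x)) = \<i> * complex_of_real (2 * w * (bose x * (x / (w\<^sup>2 + x\<^sup>2))))" if "x > 0" for x
    proof -
      have "1 + x\<^sup>2 > 0" by (simp add: add_pos_nonneg)
      hence "rho_density x * (2 * w * ((1 + x\<^sup>2) / (w\<^sup>2 + x\<^sup>2))) = 2 * w * (bose x * (x / (w\<^sup>2 + x\<^sup>2)))"
        by (simp add: rho_density_pos[OF that])
      thus ?thesis unfolding Nevanlinna_kernel_symmetrized[OF assms] scaleR_conv_of_real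
        by (metis mult.left_commute of_real_mult)
    qed
    thus "\<forall>x. x \<in> {0<..} \<longrightarrow> rho_density x *\<^sub>R (?g x + ?g (- x)) = \<i> * complex_of_real (2 * w * (bose x * (x / (w\<^sup>2 + x\<^sup>2))))"
      by blast
  qed auto
  also have "\<dots> = \<i> * of_real (w * (2 * (LBINT x:{0<..}. bose x * (x / (w\<^sup>2 + x\<^sup>2)))))"
    by (simp only: set_integral_complex_of_real set_integral_mult_right) (simp add: mult_ac)
  also have "2 * (LBINT x:{0<..}. bose x * (x / (w\<^sup>2 + x\<^sup>2))) = ln (w / 2) - Digamma (w / 2) - 1 / w"
    using Laplace_langevin_shift(3)[OF assms, of 0] Laplace_langevin[OF assms] by simp
  finally show ?thesis using assms by (simp add: algebra_simps)
qed

text \<open>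
  The total mass is read off the Nevanlinna integral at \<open>w = 1\<close>, where
  \<open>\<psi>(1/2) = -\<gamma> - 2 ln 2\<close>.
\<close>

lemma measure_rho: "measure rho UNIV = euler_mascheroni + ln 2 - 1"
proof -
  interpret finite_borel_measure rho by (rule finite_borel_measure_rho)
  have "\<i> * complex_of_real (measure rho UNIV) = \<i> * of_real (ln (1 / 2) - Digamma (1 / 2) - 1)"
    using Nevanlinna_integral_Laplace_char[of 1] Nevanlinna_integral_rho[of 1] by simp
  hence "measure rho UNIV = ln (1 / 2) - Digamma (1 / 2) - 1"
    by (simp only: mult_cancel_left of_real_eq_iff) simp
  thus ?thesis using Digamma_one_half[where 'a = real] by (simp add: ln_div)
qed

theorem proposition4:
  fixes V F :: "complex \<Rightarrow> complex"
  assumes V: "\<And>w::real. w > 0 \<Longrightarrow>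
      V (\<i> * of_real w) = \<i> * of_real (w * Digamma (w / 2) - w * ln (w / 2) + 1)"
    and F: "\<And>z. V z = - F z"
  shows "\<exists>\<rho> :: real measure.
      (\<forall>a b \<rho>'. has_characteristics F a b \<rho>' \<longleftrightarrow> a = 0 \<and> b = 0 \<and> \<rho>' = \<rho>) \<and>
      measure \<rho> UNIV = euler_mascheroni + ln 2 - 1 \<and>
      (\<forall>s. s \<noteq> 0 \<longrightarrow> char \<rho> s = of_real (fourier_S s)) \<and>
      ((\<lambda>s. complex_of_real (fourier_S s)) \<longlongrightarrow> char \<rho> 0) (at 0) \<and>
      (\<forall>s. char \<rho> s =
         of_real (2 * (LBINT x:{0..}. cos (s * x) * (x / ((1 + x\<^sup>2) * (exp (pi * x) - 1))))))"
proof (intro exI[of _ rho] conjI allI impI)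
  have FV: "F z = - V z" for z using F[of z] by simp
  have char: "has_characteristics F 0 0 rho"
    unfolding has_characteristics_def
  proof (intro conjI allI impI)
    fix w :: real assume w: "w > 0"
    show "F (\<i> * of_real w) = of_real 0 + \<i> * of_real 0 * of_real w
        + (\<integral>x. (\<i> * of_real w * of_real x - 1) / (\<i> * of_real w + of_real x) \<partial>rho)"
      unfolding FV V[OF w] Nevanlinna_integral_rho[OF w] by (simp add: algebra_simps)
  qed (simp_all add: finite_borel_measure_rho)
  show "has_characteristics F a b \<rho>' \<longleftrightarrow> a = 0 \<and> b = 0 \<and> \<rho>' = rho" for a b \<rho>'
    using char has_characteristics_unique[OF _ char] by blast
  show "measure rho UNIV = euler_mascheroni + ln 2 - 1" by (rule measure_rho)
  show closed: "char rho s = of_real (fourier_S s)" if "s \<noteq> 0" for s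
  proof -
    have "(LBINT x:{0<..}. rho_density x * cos (s * x)) = (LBINT x:{0<..}. bose x * (x * cos (s * x) / (1 + x\<^sup>2)))"
      by (intro set_lebesgue_integral_cong) (auto simp: rho_density_pos)
    thus ?thesis using cosine_transform_eq_fourier_S[OF that] by (simp only: char_rho)
  qed
  show "((\<lambda>s. complex_of_real (fourier_S s)) \<longlongrightarrow> char rho 0) (at 0)"
  proof (rule Lim_transform_eventually)
    show "(char rho \<longlongrightarrow> char rho 0) (at 0)"
      using finite_borel_measure.isCont_char[OF finite_borel_measure_rho] by (simp add: isCont_def)
    show "\<forall>\<^sub>F s in at 0. char rho s = complex_of_real (fourier_S s)"
      using closed by (auto simp: eventually_at_filter)
  qed
  show "char rho s = of_real (2 * (LBINT x:{0..}. cos (s * x) * (x / ((1 + x\<^sup>2) * (exp (pi * x) - 1)))))" for s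
  proof -
    have "(LBINT x:{0<..}. rho_density x * cos (s * x)) =
        (LBINT x:{0..}. cos (s * x) * (x / ((1 + x\<^sup>2) * (exp (pi * x) - 1))))"
      unfolding set_lebesgue_integral_def
      by (intro Bochner_Integration.integral_cong) (auto simp: indicator_def rho_density_def)
    thus ?thesis by (simp only: char_rho)
  qed
qed

end
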